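(* Let $X\subseteq\mathbb{R}^n$ be closed and convex, and let $F:X\to\mathbb{R}^n$, $F(x)=\mathbb{E}[G(x,\xi)]$, be $\mu$-strongly monotone and $L$-Lipschitz continuous on $X$. Suppose the noise assumption stated in the context holds with constants $\nu,\tilde\nu>0$. Let $x^*$ denote the solution of the variational inequality: $x^*\in X$ and $(y-x^* )^TF(x^* )\ge0$ for all $y\in X$. Consider the iterates generated by the algorithm VS-Ave described in the context, and let $N_k\triangleq\lfloor\rho^{-k}\rfloor$ with $\rho<1-\frac1{\kappa+2}$. (i) If $\kappa\triangleq\frac{L}{\mu}$ and $c\triangleq\frac{L\mu}{L+\mu}$, then for all $K$, $$\frac{\mu\,\mathbb{E}[\|\bar y_K-x^*\|^2]}{2}\le\left(g(y_0)\kappa^2+2\kappa(\nu^2+\tilde\nu^2)\left(\frac1c+\frac1\mu\right)\left(\frac{\kappa+1}{(\kappa+2)(1-\rho)-1}\right)\right)\left(1-\frac1{\kappa+2}\right)^K=Cq^K,$$ where $C$ denotes the first factor and $q=1-\frac1{\kappa+2}$. (ii) Suppose $\bar y_K$ is an $\epsilon$-solution in the sense that $\mathbb{E}[\|\bar y_K-x^*\|^2]\le\epsilon$. If $\bar C=2C/\mu$, then VS-Ave requires $\mathcal{O}(\kappa\log(\bar C/\epsilon))$ steps and $\mathcal{O}(1/\epsilon)^\beta$ evaluations, where $\rho=q^\beta$ and $\beta>1$.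
   Context: $\mu$-strong monotonicity on $X$ means $\langle F(x)-F(y),x-y\rangle\ge\mu\|x-y\|^2$ for all $x,y\in X$; $L$-Lipschitz continuity means $\|F(x)-F(y)\|\le L\|x-y\|$ for all $x,y\in X$. $\|\cdot\|$ is the Euclidean norm and $\Pi_X$ is Euclidean projection onto $X$. $\xi:\Omega\to\mathbb{R}^d$ is a random variable on a probability space $(\Omega,\mathcal{F},\mathbb{P})$ and $G:X\times\mathbb{R}^d\to\mathbb{R}^n$. Gap function: $g(x)\triangleq\sup_{y\in X}\left\{\langle F(y),x-y\rangle+\frac12\mu\|y-x\|^2\right\}$. Algorithm VS-Ave: given $y_0\in X$, set $\gamma_0=1$, $\Gamma_0=1$. For $k=0,1,2,\dots$ : (1) $x_k=\Pi_X\left[\frac{1}{\sum_{i=0}^k\gamma_i}\sum_{i=0}^k\gamma_i\left(y_i-\frac1\mu\left(F(y_i)+\bar w_{i,N_i}\right)\right)\right]$; (2) $y_{k+1}=\Pi_X\left[x_k-\frac1L\left(F(x_k)+\bar w'_{k,N_k}\right)\right]$; (3) $\gamma_{k+1}=\frac{\mu}{\mu+L}\Gamma_k$, $\Gamma_{k+1}=\Gamma_k+\gamma_{k+1}$. The averaged output is $\bar y_K=\frac1{\Gamma_K}\sum_{i=0}^K\gamma_iy_i$. "Steps" are iterations of this loop; "evaluations" are evaluations of the sampled map $G$, counted through the sample sizes $N_k$. Also write $\mathcal A_k\triangleq\max_{x\in X}\left\{\sum_{i=0}^k\gamma_i\left[\langle F(y_i)+\bar w_{i,N_i},y_i-x\rangle-\frac12\mu\|x-y_i\|^2\right]\right\}$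 (a quantity used in the analysis; it does not appear in the conclusions). Noise: $\bar w_{k,N_k}=\frac1{N_k}\sum_{j=1}^{N_k}(G(y_k,\omega_{j,k})-F(y_k))$ and $\bar w'_{k,N_k}=\frac1{N_k}\sum_{j=1}^{N_k}(G(x_k,\omega_{j,k})-F(x_k))$, where the $\omega_{j,k}$ are sampled realizations. Filtrations: $\mathcal{F}_k\triangleq\sigma\{y_0,y_1,\dots,y_{k-1}\}$ and $\mathcal{F}'_k\triangleq\sigma\{x_0,x_1,\dots,x_{k-1}\}$ (an empty list generates the trivial $\sigma$-algebra). Conditioning on $\mathcal{F}_k\cup\mathcal{F}'_{k-1}$ means conditioning on the $\sigma$-algebra generated by the union. Noise assumption: there exist $\nu,\tilde\nu>0$ such that, almost surely for all $k$, $\mathbb{E}[\bar w_{k+1,N_{k+1}}\mid\mathcal{F}_k\cup\mathcal{F}'_{k-1}]=0$, $\mathbb{E}[\bar w'_{k,N_k}\mid\mathcal{F}_k\cup\mathcal{F}'_{k-1}]=0$, $\mathbb{E}[\|\bar w_{k+1,N_{k+1}}\|^2\mid\mathcal{F}_k\cup\mathcal{F}'_{k-1}]\le\frac{\nu^2}{N_{k+1}}$ and $\mathbb{E}[\|\bar w'_{k,N_k}\|^2\mid\mathcal{F}_k\cup\mathcal{F}'_{k-1}]\le\frac{\tilde\nu^2}{N_k}$.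
   Formalization: The noise assumption is also imposed on the initial noise w̄_{0,N_0}: it has mean zero and E‖w̄_{0,N_0}‖² ≤ ν²/N_0; the assumption for k ≥ 0 alone leaves the initial noise unrestricted, and the bound in (i) then fails. *)

theory Defs
  imports "HOL-Probability.Probability" "HOL-Library.Landau_Symbols"
begin

definition strongly_monotone_on :: "real \<Rightarrow> 'a::real_inner set \<Rightarrow> ('a \<Rightarrow> 'a) \<Rightarrow> bool" where
  "strongly_monotone_on \<mu> X F \<longleftrightarrow>
     (\<forall>x\<in>X. \<forall>y\<in>X. (F x - F y) \<bullet> (x - y) \<ge> \<mu> * (norm (x - y))\<^sup>2)"

definition VI_solution :: "'a::real_inner set \<Rightarrow> ('a \<Rightarrow> 'a) \<Rightarrow> 'a \<Rightarrow> bool" where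
  "VI_solution X F z \<longleftrightarrow> z \<in> X \<and> (\<forall>y\<in>X. (y - z) \<bullet> F z \<ge> 0)"

(* For mu > 0, x in X and mu-strongly monotone F the set is bounded above by
   (norm (F x))^2 / (2 * mu), so this real-valued supremum is the true one. *)
definition gap_function :: "real \<Rightarrow> 'a::real_inner set \<Rightarrow> ('a \<Rightarrow> 'a) \<Rightarrow> 'a \<Rightarrow> real" where
  "gap_function \<mu> X F x = (SUP y\<in>X. F y \<bullet> (x - y) + 1/2 * \<mu> * (norm (y - x))\<^sup>2)"

fun gam :: "real \<Rightarrow> real \<Rightarrow> nat \<Rightarrow> real" and Gam :: "real \<Rightarrow> real \<Rightarrow> nat \<Rightarrow> real" where
  "gam \<mu> L 0 = 1"
| "gam \<mu> L (Suc k) = \<mu> / (\<mu> + L) * Gam \<mu> L k"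
| "Gam \<mu> L 0 = 1"
| "Gam \<mu> L (Suc k) = Gam \<mu> L k + gam \<mu> L (Suc k)"

definition averaged_output ::
    "real \<Rightarrow> real \<Rightarrow> (nat \<Rightarrow> 'w \<Rightarrow> 'a::real_vector) \<Rightarrow> nat \<Rightarrow> 'w \<Rightarrow> 'a" where
  "averaged_output \<mu> L y K \<omega> = (1 / Gam \<mu> L K) *\<^sub>R (\<Sum>i\<le>K. gam \<mu> L i *\<^sub>R y i \<omega>)"

definition sample_size :: "real \<Rightarrow> nat \<Rightarrow> nat" where
  "sample_size \<rho> k = nat \<lfloor>\<rho> powi (- int k)\<rfloor>"

(* Averaged error of the N k samples S 1 k, ..., S (N k) k of G at the k-th point of z;
   used with z = y and with z = x, on the same samples. *)
definition avg_noise ::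
    "('a \<Rightarrow> 'd \<Rightarrow> 'a::real_vector) \<Rightarrow> ('a \<Rightarrow> 'a) \<Rightarrow> (nat \<Rightarrow> nat \<Rightarrow> 'w \<Rightarrow> 'd) \<Rightarrow> (nat \<Rightarrow> nat)
      \<Rightarrow> (nat \<Rightarrow> 'w \<Rightarrow> 'a) \<Rightarrow> nat \<Rightarrow> 'w \<Rightarrow> 'a" where
  "avg_noise G F S N z k \<omega> =
     (1 / real (N k)) *\<^sub>R (\<Sum>j = 1..N k. G (z k \<omega>) (S j k \<omega>) - F (z k \<omega>))"

(* The sigma-algebra generated by z 0, ..., z (k - 1), trivial for k = 0.  (The library's Sup
   of vimage algebras is not used since the supremum of no measures has an empty space.) *)
definition sigma_upto :: "'w measure \<Rightarrow> (nat \<Rightarrow> 'w \<Rightarrow> 'a::topological_space) \<Rightarrow> nat \<Rightarrow> 'w measure" where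
  "sigma_upto M z k = sigma (space M) (\<Union>i<k. {z i -` A \<inter> space M |A. A \<in> sets borel})"

(* y 0, ..., y (k - 1) and x 0, ..., x (k - 2); the truncated subtraction yields no x for k = 0. *)
definition history ::
    "'w measure \<Rightarrow> (nat \<Rightarrow> 'w \<Rightarrow> 'a::topological_space) \<Rightarrow> (nat \<Rightarrow> 'w \<Rightarrow> 'a) \<Rightarrow> nat \<Rightarrow> 'w measure" where
  "history M y x k =
     sigma (space M) (sets (sigma_upto M y k) \<union> sets (sigma_upto M x (k - 1)))"

(* The library has conditional expectations only for real and ennreal values. *)
definition vec_cond_exp ::
    "'w measure \<Rightarrow> 'w measure \<Rightarrow> ('w \<Rightarrow> real^'n) \<Rightarrow> 'w \<Rightarrow> real^'n" where
  "vec_cond_exp M H f \<omega> = (\<chi> i. real_cond_exp M H (\<lambda>\<omega>. f \<omega> $ i) \<omega>)"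

locale stochastic_VI = prob_space M
  for M :: "'w measure" +
  fixes X :: "(real^'n) set" and F :: "real^'n \<Rightarrow> real^'n"
    and G :: "real^'n \<Rightarrow> real^'d \<Rightarrow> real^'n" and \<xi> :: "'w \<Rightarrow> real^'d"
    and \<mu> L :: real
  assumes X_closed: "closed X" and X_convex: "convex X"
    and \<mu>_pos: "\<mu> > 0" and L_pos: "L > 0"
    and \<xi>_rv: "\<xi> \<in> borel_measurable M"
    and G_integrable: "\<And>z. z \<in> X \<Longrightarrow> integrable M (\<lambda>\<omega>. G z (\<xi> \<omega>))"
    and F_eq: "\<And>z. z \<in> X \<Longrightarrow> F z = (\<integral>\<omega>. G z (\<xi> \<omega>) \<partial>M)"
    and F_strongly_monotone: "strongly_monotone_on \<mu> X F"
    and F_lipschitz: "L-lipschitz_on X F"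

locale VS_Ave = stochastic_VI M X F G \<xi> \<mu> L
  for M :: "'w measure" and X :: "(real^'n) set" and F G
    and \<xi> :: "'w \<Rightarrow> real^'d" and \<mu> L +
  fixes S :: "nat \<Rightarrow> nat \<Rightarrow> 'w \<Rightarrow> real^'d" and N :: "nat \<Rightarrow> nat"
    and y0 :: "real^'n" and x y :: "nat \<Rightarrow> 'w \<Rightarrow> real^'n"
  assumes S_rv: "\<And>j k. S j k \<in> borel_measurable M"
    and S_distr: "\<And>j k. distr M borel (S j k) = distr M borel \<xi>"
    and y0_in: "y0 \<in> X"
    and y_0: "\<And>\<omega>. \<omega> \<in> space M \<Longrightarrow> y 0 \<omega> = y0"
    and x_step: "\<And>k \<omega>. \<omega> \<in> space M \<Longrightarrow>
      x k \<omega> = closest_point X ((1 / (\<Sum>i\<le>k. gam \<mu> L i)) *\<^sub>R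
        (\<Sum>i\<le>k. gam \<mu> L i *\<^sub>R
          (y i \<omega> - (1/\<mu>) *\<^sub>R (F (y i \<omega>) + avg_noise G F S N y i \<omega>))))"
    and y_step: "\<And>k \<omega>. \<omega> \<in> space M \<Longrightarrow>
      y (Suc k) \<omega> = closest_point X
        (x k \<omega> - (1/L) *\<^sub>R (F (x k \<omega>) + avg_noise G F S N x k \<omega>))"

(* The conditional second moments are taken as nn_cond_exp, which is meaningful without prior
   integrability; the bounds make the noise square-integrable, so that vec_cond_exp is meaningful
   too.  The first-iteration noise avg_noise G F S N y 0 is the index k = -1 of the conditions on
   avg_noise G F S N y (Suc k): there the history is empty and the conditional expectations are
   plain ones. *)
locale VS_Ave_noise = VS_Ave M X F G \<xi> \<mu> L S N y0 x y
  for M :: "'w measure" and X :: "(real^'n) set" and F G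
    and \<xi> :: "'w \<Rightarrow> real^'d" and \<mu> L S N y0 x y +
  fixes \<nu> \<nu>' :: real
  assumes \<nu>_pos: "\<nu> > 0" and \<nu>'_pos: "\<nu>' > 0"
    and noise_y_rv: "\<And>k. avg_noise G F S N y k \<in> borel_measurable M"
    and noise_x_rv: "\<And>k. avg_noise G F S N x k \<in> borel_measurable M"
    and noise_y_0_mean: "(\<integral>\<omega>. avg_noise G F S N y 0 \<omega> \<partial>M) = 0"
    and noise_y_0_bound:
      "(\<integral>\<^sup>+\<omega>. ennreal ((norm (avg_noise G F S N y 0 \<omega>))\<^sup>2) \<partial>M) \<le> ennreal (\<nu>\<^sup>2 / real (N 0))"
    and noise: "AE \<omega> in M. \<forall>k.
      vec_cond_exp M (history M y x k) (avg_noise G F S N y (Suc k)) \<omega> = 0 \<and>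
      vec_cond_exp M (history M y x k) (avg_noise G F S N x k) \<omega> = 0 \<and>
      nn_cond_exp M (history M y x k)
        (\<lambda>\<omega>. ennreal ((norm (avg_noise G F S N y (Suc k) \<omega>))\<^sup>2)) \<omega> \<le> ennreal (\<nu>\<^sup>2 / real (N (Suc k))) \<and>
      nn_cond_exp M (history M y x k)
        (\<lambda>\<omega>. ennreal ((norm (avg_noise G F S N x k \<omega>))\<^sup>2)) \<omega> \<le> ennreal (\<nu>'\<^sup>2 / real (N k))"

definition eps_solution ::
    "'w measure \<Rightarrow> 'a::real_normed_vector \<Rightarrow> (nat \<Rightarrow> 'w \<Rightarrow> 'a) \<Rightarrow> real \<Rightarrow> nat \<Rightarrow> bool" where
  "eps_solution M xs ybar \<epsilon> K \<longleftrightarrow>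
     integrable M (\<lambda>\<omega>. (norm (ybar K \<omega> - xs))\<^sup>2) \<and>
     (\<integral>\<omega>. (norm (ybar K \<omega> - xs))\<^sup>2 \<partial>M) \<le> \<epsilon>"

(* Only meaningful if some K satisfies eps_solution. *)
definition steps_required ::
    "'w measure \<Rightarrow> 'a::real_normed_vector \<Rightarrow> (nat \<Rightarrow> 'w \<Rightarrow> 'a) \<Rightarrow> real \<Rightarrow> nat" where
  "steps_required M xs ybar \<epsilon> = (LEAST K. eps_solution M xs ybar \<epsilon> K)"

(* ybar K is available after the iterations k = 0, ..., K - 1; iteration k evaluates
   G at y k and at x k, N k times each. *)
definition evaluations :: "(nat \<Rightarrow> nat) \<Rightarrow> nat \<Rightarrow> nat" where
  "evaluations N K = (\<Sum>k<K. 2 * N k)"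

end

theory Submission
  imports Defs
begin

text \<open>The function \<open>merit\<close> is strongly concave and maximised on \<open>X\<close> by \<open>x\<^sub>k\<close>. Its maximum grows from one
  iteration to the next only by noise terms, its first maximum is at most \<open>\<kappa>\<^sup>2 g(y\<^sub>0)\<close> up to noise,
  and its value at the solution dominates \<open>\<mu> \<Gamma>\<^sub>K / 2\<close> times the squared error of the averaged output,
  where \<open>\<Gamma>\<^sub>K = q\<^sup>-\<^sup>K\<close>. The noise at \<open>y\<^sub>k\<^sub>+\<^sub>1\<close> is centred only relative to a history that lags behind
  the iterates, so it correlates with the last increments of the \<open>x\<close>-iterates; that correlation is absorbed by
  squares of increments which the usual analysis discards. If \<open>X\<close> is not a singleton, then
  \<open>\<kappa> \<ge> 1\<close>, which gives the constants the necessary slack.\<close>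

section \<open>Step sizes\<close>

text \<open>The recursion for the step sizes amounts to
  \<open>\<mu> * Gam \<mu> L k = (\<mu> + L) * gam \<mu> L (Suc k)\<close>. Strong concavity of
  \<open>merit\<close> therefore yields \<open>(\<mu> + L) / 2\<close> times the weighted squared
  increment of \<open>x\<close>: the part \<open>L / 2\<close> pays for the extragradient step, and
  \<open>\<mu> / 2\<close> is the reserve for the lagging noise. The noise at one
  \<open>y\<close>-iterate correlates with at most three increments, so each increment is charged at
  most three times and its reserve is cut into shares of \<open>\<mu> / 6\<close>. Young's
  inequality then raises the variance coefficient to \<open>57 / (8 * \<mu>)\<close>. This is
  affordable: for \<open>\<mu> \<le> L\<close> the step sizes contribute a factor of at most 1/3
  relative to the geometric series that is summed, so that even after the factor 2 lost to rounding
  the sample sizes the coefficient stays below \<open>6 / \<mu>\<close>, while the claimed constant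
  offers \<open>2 * (2 * \<kappa> + 1) / \<mu>\<close>. The initial noise \<open>noise_y 0\<close>
  is correlated with \<open>x 0\<close>, which has no predecessor; the deterministic point
  \<open>x_start\<close> is supplied as one.\<close>

lemma sum_gam: "(\<Sum>i\<le>k. gam \<mu> L i) = Gam \<mu> L k"
  by (induction k) simp_all

lemma Gam_eq_power: "Gam \<mu> L k = (1 + \<mu> / (\<mu> + L)) ^ k"
  by (induction k) (simp_all add: algebra_simps)

lemma gam_Suc_eq_power: "gam \<mu> L (Suc k) = \<mu> / (\<mu> + L) * (1 + \<mu> / (\<mu> + L)) ^ k"
  by (simp add: Gam_eq_power)

lemma gam_pos: "\<mu> > 0 \<Longrightarrow> L > 0 \<Longrightarrow> gam \<mu> L k > 0"
  by (cases k) (auto simp: gam_Suc_eq_power intro!: mult_pos_pos zero_less_power add_pos_pos divide_pos_pos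
    simp del: gam.simps(2))

lemma Gam_pos: "\<mu> > 0 \<Longrightarrow> L > 0 \<Longrightarrow> Gam \<mu> L k > 0"
  by (simp add: Gam_eq_power add_pos_pos)

text \<open>From index 1 on the step sizes are geometric with exactly this ratio; only the passage
  from \<open>gam \<mu> L 0 = 1\<close> makes it an inequality.\<close>

lemma gam_Suc_le:
  assumes "\<mu> > 0" "L > 0"
  shows "gam \<mu> L (Suc k) \<le> (1 + \<mu> / (\<mu> + L)) * gam \<mu> L k"
proof (cases k)
  case 0
  then show ?thesis using assms by simp
next
  case (Suc j)
  then show ?thesis unfolding Suc gam_Suc_eq_power power_Suc by (simp only: mult_ac order_refl)
qed

section \<open>Inequalities in inner product spaces\<close>

lemma inner_le_Young:
  fixes u v :: "'a::real_inner"
  assumes "t > 0"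
  shows "u \<bullet> v \<le> t / 2 * (norm u)\<^sup>2 + 1 / (2 * t) * (norm v)\<^sup>2"
proof -
  have "0 \<le> (norm (t *\<^sub>R u - v))\<^sup>2 / (2 * t)" using assms by simp
  also have "\<dots> = t / 2 * (norm u)\<^sup>2 + 1 / (2 * t) * (norm v)\<^sup>2 - u \<bullet> v"
    using assms unfolding power2_norm_eq_inner
    by (simp add: inner_diff_left inner_diff_right inner_commute field_simps power2_eq_square)
  finally show ?thesis by simp
qed

text \<open>Variance decomposition: the right side is the weighted spread about the mean
  \<open>m\<close> plus the left side, since the deviations from \<open>m\<close> have weighted sum
  0 and the cross term vanishes.\<close>

lemma norm_convex_comb_sq_le:
  fixes u :: "'i \<Rightarrow> 'a::real_inner"
  assumes "\<And>i. i \<in> I \<Longrightarrow> c i \<ge> 0" "sum c I = s" "s > 0"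
  shows "s * (norm ((1 / s) *\<^sub>R (\<Sum>i\<in>I. c i *\<^sub>R u i) - v))\<^sup>2 \<le> (\<Sum>i\<in>I. c i * (norm (u i - v))\<^sup>2)"
proof -
  define m where "m = (1 / s) *\<^sub>R (\<Sum>i\<in>I. c i *\<^sub>R u i)"
  have sm: "(\<Sum>i\<in>I. c i *\<^sub>R u i) = s *\<^sub>R m" using assms by (simp add: m_def)
  have "(\<Sum>i\<in>I. c i * (norm (u i - v))\<^sup>2)
      = (\<Sum>i\<in>I. c i * (norm (u i - m))\<^sup>2 + 2 * ((c i *\<^sub>R u i - c i *\<^sub>R m) \<bullet> (m - v)) + c i * (norm (m - v))\<^sup>2)"
    by (intro sum.cong refl)
      (simp add: power2_norm_eq_inner inner_diff_left inner_diff_right inner_commute algebra_simps)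
  also have "\<dots> = (\<Sum>i\<in>I. c i * (norm (u i - m))\<^sup>2) + 2 * ((s *\<^sub>R m - s *\<^sub>R m) \<bullet> (m - v)) + s * (norm (m - v))\<^sup>2"
    by (simp add: sm assms(2) sum.distrib sum_subtractf
        flip: sum_distrib_left sum_distrib_right inner_sum_left scaleR_sum_left)
  finally show ?thesis
    unfolding m_def[symmetric] using assms(1) by (simp add: sum_nonneg)
qed

section \<open>The gap function\<close>

context stochastic_VI
begin

lemma monotone: "u \<in> X \<Longrightarrow> v \<in> X \<Longrightarrow> (F u - F v) \<bullet> (u - v) \<ge> \<mu> * (norm (u - v))\<^sup>2"
  using F_strongly_monotone unfolding strongly_monotone_on_def by blast

lemma lipschitz: "u \<in> X \<Longrightarrow> v \<in> X \<Longrightarrow> norm (F u - F v) \<le> L * norm (u - v)"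
  using lipschitz_onD[OF F_lipschitz] by (simp add: dist_norm)

lemma inner_F_diff_le:
  assumes "u \<in> X" "v \<in> X"
  shows "(F u - F v) \<bullet> z \<le> L * norm (u - v) * norm z"
proof -
  have "(F u - F v) \<bullet> z \<le> norm (F u - F v) * norm z" by (rule norm_cauchy_schwarz)
  also have "\<dots> \<le> L * norm (u - v) * norm z"
    using lipschitz[OF assms] by (rule mult_right_mono) simp
  finally show ?thesis .
qed

text \<open>Strong monotonicity and Lipschitz continuity bound the same inner product from below and
  above. On a singleton both are void and nothing relates \<open>\<mu>\<close> to
  \<open>L\<close>.\<close>

lemma \<mu>_le_L:
  assumes "u \<in> X" "v \<in> X" "u \<noteq> v"
  shows "\<mu> \<le> L"
proof -
  have "\<mu> * (norm (u - v))\<^sup>2 \<le> L * (norm (u - v))\<^sup>2"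
    using monotone[OF assms(1,2)] inner_F_diff_le[OF assms(1,2), of "u - v"]
    by (simp add: power2_eq_square mult.assoc)
  then show ?thesis using assms(3) by simp
qed

text \<open>Replacing \<open>F v\<close> by \<open>F u\<close> gains
  \<open>\<mu> * (norm (u - v))\<^sup>2\<close>. One half cancels the quadratic term of the gap, the
  other absorbs the remainder of Young's inequality. The resulting bound is free of
  \<open>v\<close>, so the real-valued supremum is meaningful.\<close>

lemma gap_integrand_le:
  assumes "u \<in> X" "v \<in> X"
  shows "F v \<bullet> (u - v) + 1/2 * \<mu> * (norm (v - u))\<^sup>2 \<le> (norm (F u))\<^sup>2 / (2 * \<mu>)"
proof -
  have "F v \<bullet> (u - v) = F u \<bullet> (u - v) - (F u - F v) \<bullet> (u - v)" by (simp add: inner_diff_left)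
  also have "\<dots> \<le> F u \<bullet> (u - v) - \<mu> * (norm (u - v))\<^sup>2" using monotone[OF assms] by simp
  also have "F u \<bullet> (u - v) \<le> 1/\<mu> / 2 * (norm (F u))\<^sup>2 + 1 / (2 * (1/\<mu>)) * (norm (u - v))\<^sup>2"
    using \<mu>_pos by (intro inner_le_Young) simp
  finally show ?thesis by (simp add: norm_minus_commute)
qed

lemma gap_bdd_above:
  assumes "u \<in> X"
  shows "bdd_above ((\<lambda>v. F v \<bullet> (u - v) + 1/2 * \<mu> * (norm (v - u))\<^sup>2) ` X)"
  using gap_integrand_le[OF assms] by (auto intro!: bdd_aboveI)

lemma gap_upper:
  assumes "u \<in> X" "v \<in> X"
  shows "F v \<bullet> (u - v) + 1/2 * \<mu> * (norm (v - u))\<^sup>2 \<le> gap_function \<mu> X F u"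
  unfolding gap_function_def using gap_bdd_above assms by (intro cSUP_upper) auto

lemma gap_nonneg: "u \<in> X \<Longrightarrow> gap_function \<mu> X F u \<ge> 0"
  using gap_upper[of u u] by simp

text \<open>The gap function is tested at the point \<open>u + t (v - u)\<close> with \<open>t = 1 / (2 L / \<mu> - 1)\<close>, which
  gives the factor \<open>2 L / \<mu> - 1 \<le> (L / \<mu>)\<^sup>2\<close>.\<close>

lemma dual_gap_le_gap:
  assumes "u \<in> X" "v \<in> X"
  shows "F u \<bullet> (u - v) - \<mu> / 2 * (norm (v - u))\<^sup>2 \<le> (L / \<mu>)\<^sup>2 * gap_function \<mu> X F u"
proof (cases "u = v")
  case True
  then show ?thesis using gap_nonneg[OF assms(1)] by simp
next
  case False
  define \<kappa> where "\<kappa> = L / \<mu>"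
  have \<kappa>: "\<kappa> \<ge> 1" using \<mu>_le_L[OF assms False] \<mu>_pos by (simp add: \<kappa>_def)
  have L: "L = \<kappa> * \<mu>" using \<mu>_pos by (simp add: \<kappa>_def)
  define t where "t = 1 / (2 * \<kappa> - 1)"
  have t: "t > 0" "t \<le> 1" "t * (2 * \<kappa> - 1) = 1" using \<kappa> by (auto simp: t_def)
  define z where "z = u + t *\<^sub>R (v - u)"
  have "z = (1 - t) *\<^sub>R u + t *\<^sub>R v" by (simp add: z_def algebra_simps)
  then have z: "z \<in> X" using X_convex assms t by (simp add: convexD)
  have uz: "u - z = t *\<^sub>R (u - v)" by (simp add: z_def algebra_simps)
  have "(F u - F z) \<bullet> (u - v) \<le> L * norm (u - z) * norm (u - v)"
    using assms z by (intro inner_F_diff_le)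
  also have nz: "norm (u - z) = t * norm (v - u)" using t by (simp add: z_def)
  finally have "(F u - F z) \<bullet> (u - v) \<le> L * (t * norm (v - u)) * norm (u - v)" .
  then have 1: "F z \<bullet> (u - v) \<ge> F u \<bullet> (u - v) - L * t * (norm (v - u))\<^sup>2"
    by (simp add: inner_diff_left power2_eq_square mult_ac norm_minus_commute)
  \<comment> \<open>\<open>t\<close> is the value at which the last summand vanishes, so that no
    quadratic term is lost when passing to the gap at \<open>z\<close>.\<close>
  have "t * (F u \<bullet> (u - v) - \<mu> / 2 * (norm (v - u))\<^sup>2)
      = t * (F u \<bullet> (u - v) - L * t * (norm (v - u))\<^sup>2) + 1/2 * \<mu> * (t * norm (v - u))\<^sup>2
        + \<mu> / 2 * t * (norm (v - u))\<^sup>2 * (t * (2 * \<kappa> - 1) - 1)"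
    by (simp add: L power2_eq_square field_simps)
  also have "\<dots> = t * (F u \<bullet> (u - v) - L * t * (norm (v - u))\<^sup>2) + 1/2 * \<mu> * (t * norm (v - u))\<^sup>2"
    using t(3) by simp
  also have "\<dots> \<le> t * (F z \<bullet> (u - v)) + 1/2 * \<mu> * (t * norm (v - u))\<^sup>2"
    using 1 t by (intro add_right_mono mult_left_mono) auto
  also have "\<dots> = F z \<bullet> (u - z) + 1/2 * \<mu> * (norm (z - u))\<^sup>2"
    using t by (simp add: uz nz norm_minus_commute[of z] norm_minus_commute[of v])
  also have "\<dots> \<le> gap_function \<mu> X F u" using assms z by (intro gap_upper)
  finally have "F u \<bullet> (u - v) - \<mu> / 2 * (norm (v - u))\<^sup>2 \<le> (2 * \<kappa> - 1) * gap_function \<mu> X F u"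
    using t(1) \<kappa> by (simp add: t_def field_simps)
  also have "\<dots> \<le> \<kappa>\<^sup>2 * gap_function \<mu> X F u"
  proof (rule mult_right_mono)
    have "0 \<le> (\<kappa> - 1)\<^sup>2" by simp
    then show "2 * \<kappa> - 1 \<le> \<kappa>\<^sup>2" by (simp add: power2_diff)
  qed (rule gap_nonneg[OF assms(1)])
  finally show ?thesis by (simp add: \<kappa>_def)
qed

end

section \<open>Pathwise estimates\<close>

lemma closest_point_obtuse:
  assumes "convex X" "closed X" "z \<in> X" "p = closest_point X (u::'a::euclidean_space)"
  shows "p \<in> X" "(u - p) \<bullet> (z - p) \<le> 0"
  using closest_point_in_set[of X u] closest_point_dot[of X z u] assms by auto

context VS_Ave
begin

abbreviation "noise_y \<equiv> avg_noise G F S N y"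
abbreviation "noise_x \<equiv> avg_noise G F S N x"

lemma x_in: "\<omega> \<in> space M \<Longrightarrow> x k \<omega> \<in> X"
  using x_step[of \<omega> k] closest_point_in_set[OF X_closed] y0_in by auto

lemma y_in: "\<omega> \<in> space M \<Longrightarrow> y k \<omega> \<in> X"
  using y_0[of \<omega>] y_step[of \<omega>] closest_point_in_set[OF X_closed] y0_in by (cases k) auto

text \<open>In the paper's \<open>\<A>\<^sub>k\<close> the noise is paired with \<open>y\<^sub>i - z\<close>; pairing it with \<open>p - z\<close> instead
  changes the function by a constant in \<open>z\<close> only, so that \<open>x\<^sub>k\<close> is still its maximiser.\<close>

definition merit :: "real^'n \<Rightarrow> nat \<Rightarrow> 'w \<Rightarrow> real^'n \<Rightarrow> real" where
  "merit p k \<omega> z = (\<Sum>i\<le>k. gam \<mu> L i *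
     (F (y i \<omega>) \<bullet> (y i \<omega> - z) + noise_y i \<omega> \<bullet> (p - z) - \<mu> / 2 * (norm (z - y i \<omega>))\<^sup>2))"

text \<open>As a function of \<open>z\<close>, \<open>merit p k \<omega>\<close> is a quadratic with
  Hessian \<open>- \<mu> * Gam \<mu> L k\<close> times the identity, and its unconstrained maximiser
  is the point \<open>u\<close> that the algorithm projects. The obtuse angle at the projection is
  the first-order optimality condition on \<open>X\<close>.\<close>

lemma merit_le_x:
  assumes \<omega>: "\<omega> \<in> space M" and z: "z \<in> X"
  shows "merit p k \<omega> z \<le> merit p k \<omega> (x k \<omega>) - \<mu> / 2 * Gam \<mu> L k * (norm (z - x k \<omega>))\<^sup>2"
proof -
  define g where "g i = gam \<mu> L i" for i
  define f where "f i = F (y i \<omega>) + noise_y i \<omega>" for i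
  define u where "u = (1 / (\<Sum>i\<le>k. g i)) *\<^sub>R (\<Sum>i\<le>k. g i *\<^sub>R (y i \<omega> - (1/\<mu>) *\<^sub>R f i))"
  let ?x = "x k \<omega>" and ?\<Gamma> = "Gam \<mu> L k"
  have sg: "(\<Sum>i\<le>k. g i) = ?\<Gamma>" by (simp add: g_def sum_gam)
  have \<Gamma>: "?\<Gamma> > 0" using Gam_pos[OF \<mu>_pos L_pos] .
  have "?x = closest_point X u"
    using x_step[OF \<omega>, of k] by (simp add: u_def f_def g_def)
  from closest_point_obtuse[OF X_convex X_closed z this]
  have ob: "(u - ?x) \<bullet> (z - ?x) \<le> 0" by simp
  have *: "?\<Gamma> *\<^sub>R u = (\<Sum>i\<le>k. g i *\<^sub>R (y i \<omega> - (1/\<mu>) *\<^sub>R f i))" using \<Gamma> by (simp add: u_def sg)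
  \<comment> \<open>Both sides are the gradient of \<open>merit p k \<omega>\<close> at
    \<open>?x\<close>.\<close>
  have u: "(\<mu> * ?\<Gamma>) *\<^sub>R (u - ?x) = - (\<Sum>i\<le>k. g i *\<^sub>R (f i + \<mu> *\<^sub>R (?x - y i \<omega>)))"
  proof -
    have "(\<mu> * ?\<Gamma>) *\<^sub>R (u - ?x) = \<mu> *\<^sub>R (?\<Gamma> *\<^sub>R u) - \<mu> *\<^sub>R (?\<Gamma> *\<^sub>R ?x)"
      by (simp add: algebra_simps)
    also have "\<dots> = (\<Sum>i\<le>k. \<mu> *\<^sub>R (g i *\<^sub>R (y i \<omega> - (1/\<mu>) *\<^sub>R f i)) - \<mu> *\<^sub>R (g i *\<^sub>R ?x))"
      unfolding * sum_subtractf by (simp add: scaleR_sum_right scaleR_sum_left flip: sg)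
    also have "\<dots> = (\<Sum>i\<le>k. - (g i *\<^sub>R (f i + \<mu> *\<^sub>R (?x - y i \<omega>))))"
      using \<mu>_pos by (intro sum.cong refl) (simp add: algebra_simps)
    finally show ?thesis by (simp add: sum_negf)
  qed
  have "merit p k \<omega> z - merit p k \<omega> ?x
      = (\<Sum>i\<le>k. (g i *\<^sub>R (f i + \<mu> *\<^sub>R (?x - y i \<omega>))) \<bullet> (?x - z) - g i * (\<mu> / 2 * (norm (z - ?x))\<^sup>2))"
    unfolding merit_def sum_subtractf[symmetric] g_def[symmetric] f_def power2_norm_eq_inner
    by (intro sum.cong refl) (simp add: inner_diff_left inner_diff_right inner_add_left inner_add_right inner_commute field_simps)
  also have "\<dots> = (- ((\<mu> * ?\<Gamma>) *\<^sub>R (u - ?x))) \<bullet> (?x - z) - ?\<Gamma> * (\<mu> / 2 * (norm (z - ?x))\<^sup>2)"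
    unfolding u by (simp add: sum_subtractf inner_sum_left sum_distrib_right flip: sg)
  also have "\<dots> = \<mu> * ?\<Gamma> * ((u - ?x) \<bullet> (z - ?x)) - ?\<Gamma> * (\<mu> / 2 * (norm (z - ?x))\<^sup>2)"
    by (simp add: inner_diff_right algebra_simps)
  also have "\<dots> \<le> - ?\<Gamma> * (\<mu> / 2 * (norm (z - ?x))\<^sup>2)"
    using ob \<Gamma> \<mu>_pos by (simp add: mult_le_0_iff)
  finally show ?thesis by (simp add: algebra_simps)
qed

text \<open>The projection defining \<open>?b\<close> controls the new summand with
  \<open>F ?a\<close> in place of \<open>F ?b\<close>, up to \<open>L / 2\<close> times the three
  squares in \<open>three\<close>. Its two negative squares pay for exchanging \<open>F ?a\<close>
  and \<open>F ?b\<close> by Lipschitz continuity. The noise at \<open>?a\<close> is split by Young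
  so that its square of \<open>?z - ?b\<close> is cancelled by the quadratic term of the new
  summand. The remaining \<open>L / 2\<close> times the square of \<open>?z - ?a\<close> is paid by
  the concavity of the old \<open>merit\<close>, which leaves the negative square in the
  conclusion.\<close>

lemma merit_step:
  assumes \<omega>: "\<omega> \<in> space M"
  shows "merit p (Suc k) \<omega> (x (Suc k) \<omega>) \<le> merit p k \<omega> (x k \<omega>) +
    gam \<mu> L (Suc k) * (noise_y (Suc k) \<omega> \<bullet> (p - x (Suc k) \<omega>)
      + (norm (noise_x k \<omega>))\<^sup>2 / (2 * \<mu>) - \<mu> / 2 * (norm (x (Suc k) \<omega> - x k \<omega>))\<^sup>2)"
proof -
  let ?a = "x k \<omega>" and ?b = "y (Suc k) \<omega>" and ?z = "x (Suc k) \<omega>" and ?v = "noise_x k \<omega>"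
  let ?g = "gam \<mu> L (Suc k)"
  have g: "?g > 0" using gam_pos[OF \<mu>_pos L_pos] .
  have in_X: "?a \<in> X" "?b \<in> X" "?z \<in> X" using x_in y_in \<omega> by auto
  have \<Gamma>: "\<mu> * Gam \<mu> L k = (\<mu> + L) * ?g" using \<mu>_pos L_pos by (simp add: field_simps)
  have "(?a - (1/L) *\<^sub>R (F ?a + ?v) - ?b) \<bullet> (?z - ?b) \<le> 0"
    using closest_point_obtuse(2)[OF X_convex X_closed in_X(3) y_step[OF \<omega>]] .
  then have "L * ((?a - (1/L) *\<^sub>R (F ?a + ?v) - ?b) \<bullet> (?z - ?b)) \<le> 0"
    using L_pos by (simp add: mult_le_0_iff)
  then have proj: "(F ?a + ?v) \<bullet> (?b - ?z) \<le> L * ((?b - ?a) \<bullet> (?z - ?b))"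
    using L_pos by (simp add: inner_diff_left inner_diff_right inner_add_left algebra_simps)
  have three: "(?b - ?a) \<bullet> (?z - ?b) = ((norm (?z - ?a))\<^sup>2 - (norm (?z - ?b))\<^sup>2 - (norm (?b - ?a))\<^sup>2) / 2"
    by (simp add: power2_norm_eq_inner inner_diff_left inner_diff_right inner_commute)
  have lip: "(F ?b - F ?a) \<bullet> (?b - ?z) \<le> L / 2 * ((norm (?b - ?a))\<^sup>2 + (norm (?z - ?b))\<^sup>2)"
  proof -
    have "2 * (norm (?b - ?a) * norm (?z - ?b)) \<le> (norm (?b - ?a))\<^sup>2 + (norm (?z - ?b))\<^sup>2"
      using sum_squares_bound[of "norm (?b - ?a)" "norm (?z - ?b)"] by (simp add: mult.assoc)
    then have "L / 2 * (2 * (norm (?b - ?a) * norm (?z - ?b))) \<le> L / 2 * ((norm (?b - ?a))\<^sup>2 + (norm (?z - ?b))\<^sup>2)"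
      using L_pos by (intro mult_left_mono) auto
    then show ?thesis
      using inner_F_diff_le[OF in_X(2,1), of "?b - ?z"] by (simp add: norm_minus_commute mult.assoc)
  qed
  have noise: "- (?v \<bullet> (?b - ?z)) \<le> (norm ?v)\<^sup>2 / (2 * \<mu>) + \<mu> / 2 * (norm (?z - ?b))\<^sup>2"
    using inner_le_Young[of "1 / \<mu>" ?v "?z - ?b"] \<mu>_pos by (simp add: inner_diff_right)
  have "F ?b \<bullet> (?b - ?z) = (F ?b - F ?a) \<bullet> (?b - ?z) + (F ?a + ?v) \<bullet> (?b - ?z) - ?v \<bullet> (?b - ?z)"
    by (simp add: inner_diff_left inner_add_left)
  also have "\<dots> \<le> L / 2 * (norm (?z - ?a))\<^sup>2 + (norm ?v)\<^sup>2 / (2 * \<mu>) + \<mu> / 2 * (norm (?z - ?b))\<^sup>2"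
    using proj lip noise unfolding three by (simp add: algebra_simps)
  finally have "?g * (F ?b \<bullet> (?b - ?z)) \<le>
    ?g * (L / 2 * (norm (?z - ?a))\<^sup>2 + (norm ?v)\<^sup>2 / (2 * \<mu>) + \<mu> / 2 * (norm (?z - ?b))\<^sup>2)"
    using g by (intro mult_left_mono) auto
  moreover have "merit p k \<omega> ?z \<le> merit p k \<omega> ?a - (\<mu> * Gam \<mu> L k) / 2 * (norm (?z - ?a))\<^sup>2"
    using merit_le_x[OF \<omega> in_X(3), of p k] by simp
  moreover have "merit p (Suc k) \<omega> ?z = merit p k \<omega> ?z +
    ?g * (F ?b \<bullet> (?b - ?z) + noise_y (Suc k) \<omega> \<bullet> (p - ?z) - \<mu> / 2 * (norm (?z - ?b))\<^sup>2)"
    by (simp add: merit_def del: gam.simps(2))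
  ultimately show ?thesis unfolding \<Gamma> by (simp add: algebra_simps add_divide_distrib del: gam.simps(2))
qed

text \<open>Here \<open>merit\<close> has a single summand of weight 1, whose noise-free part is the
  left side of \<open>dual_gap_le_gap\<close> with \<open>u = y0\<close> and
  \<open>v = x 0 \<omega>\<close>.\<close>

lemma merit_0_le:
  assumes "\<omega> \<in> space M"
  shows "merit p 0 \<omega> (x 0 \<omega>) \<le> (L / \<mu>)\<^sup>2 * gap_function \<mu> X F y0 + noise_y 0 \<omega> \<bullet> (p - x 0 \<omega>)"
  using dual_gap_le_gap[OF y0_in x_in[OF assms, of 0]] y_0[OF assms] by (simp add: merit_def)

text \<open>At \<open>z = p\<close> the noise terms of \<open>merit\<close> vanish, so the bound
  holds for every outcome. Strong monotonicity and the variational inequality give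
  \<open>\<mu>\<close> times the squared distance, of which the quadratic term of
  \<open>merit\<close> takes half; convexity passes to the average.\<close>

lemma merit_solution_ge:
  assumes \<omega>: "\<omega> \<in> space M" and p: "VI_solution X F p"
  shows "\<mu> / 2 * Gam \<mu> L k * (norm (averaged_output \<mu> L y k \<omega> - p))\<^sup>2 \<le> merit p k \<omega> (x k \<omega>)"
proof -
  have pX: "p \<in> X" using p by (simp add: VI_solution_def)
  have "Gam \<mu> L k * (norm (averaged_output \<mu> L y k \<omega> - p))\<^sup>2 \<le> (\<Sum>i\<le>k. gam \<mu> L i * (norm (y i \<omega> - p))\<^sup>2)"
    unfolding averaged_output_def
    by (intro norm_convex_comb_sq_le less_imp_le gam_pos Gam_pos \<mu>_pos L_pos sum_gam)
  then have "\<mu> / 2 * (Gam \<mu> L k * (norm (averaged_output \<mu> L y k \<omega> - p))\<^sup>2)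
      \<le> \<mu> / 2 * (\<Sum>i\<le>k. gam \<mu> L i * (norm (y i \<omega> - p))\<^sup>2)"
    using \<mu>_pos by (intro mult_left_mono) auto
  also have "\<dots> = (\<Sum>i\<le>k. gam \<mu> L i * (\<mu> / 2 * (norm (y i \<omega> - p))\<^sup>2))"
    by (simp add: sum_distrib_left mult_ac)
  also have "\<dots> \<le> merit p k \<omega> p"
    unfolding merit_def
  proof (intro sum_mono mult_left_mono less_imp_le[OF gam_pos] \<mu>_pos L_pos)
    fix i
    have yX: "y i \<omega> \<in> X" using y_in \<omega> by simp
    have "(y i \<omega> - p) \<bullet> F p \<ge> 0" using p yX by (simp add: VI_solution_def)
    then show "\<mu> / 2 * (norm (y i \<omega> - p))\<^sup>2
        \<le> F (y i \<omega>) \<bullet> (y i \<omega> - p) + noise_y i \<omega> \<bullet> (p - p) - \<mu> / 2 * (norm (p - y i \<omega>))\<^sup>2"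
      using monotone[OF yX pX]
      by (simp add: inner_diff_left norm_minus_commute inner_commute[of "F p"] inner_diff_right)
  qed
  also have "\<dots> \<le> merit p k \<omega> (x k \<omega>)"
  proof -
    have "0 \<le> \<mu> / 2 * Gam \<mu> L k * (norm (p - x k \<omega>))\<^sup>2"
      using \<mu>_pos less_imp_le[OF Gam_pos[OF \<mu>_pos L_pos]] by simp
    then show ?thesis using merit_le_x[OF \<omega> pX, of p k] by simp
  qed
  finally show ?thesis by (simp add: mult.assoc)
qed

text \<open>The first projection with its noise left out. It is deterministic, hence uncorrelated
  with \<open>noise_y 0\<close>, and nonexpansiveness of the projection bounds its distance to
  \<open>x 0\<close> by that noise.\<close>

definition x_start :: "real^'n" where
  "x_start = closest_point X (y0 - (1/\<mu>) *\<^sub>R F y0)"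

lemma x_0_near_start:
  assumes \<omega>: "\<omega> \<in> space M"
  shows "norm (x 0 \<omega> - x_start) \<le> norm (noise_y 0 \<omega>) / \<mu>"
proof -
  have "dist (x 0 \<omega>) x_start \<le> dist (y0 - (1/\<mu>) *\<^sub>R (F y0 + noise_y 0 \<omega>)) (y0 - (1/\<mu>) *\<^sub>R F y0)"
    unfolding x_start_def using x_step[OF \<omega>, of 0] y_0[OF \<omega>] y0_in
    by (auto intro!: closest_point_lipschitz X_convex X_closed)
  also have "\<dots> = norm (noise_y 0 \<omega>) / \<mu>"
    using \<mu>_pos by (simp add: dist_norm algebra_simps)
  finally show ?thesis by (simp add: dist_norm)
qed

end

section \<open>Square-integrable random vectors\<close>

definition square_integrable :: "'w measure \<Rightarrow> ('w \<Rightarrow> 'a::euclidean_space) \<Rightarrow> bool" where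
  "square_integrable M f \<longleftrightarrow> f \<in> borel_measurable M \<and> integrable M (\<lambda>\<omega>. (norm (f \<omega>))\<^sup>2)"

lemma square_integrable_measurable: "square_integrable M f \<Longrightarrow> f \<in> borel_measurable M"
  by (simp add: square_integrable_def)

lemma square_integrable_norm_sq: "square_integrable M f \<Longrightarrow> integrable M (\<lambda>\<omega>. (norm (f \<omega>))\<^sup>2)"
  by (simp add: square_integrable_def)

lemma square_integrable_cong:
  "(\<And>\<omega>. \<omega> \<in> space M \<Longrightarrow> f \<omega> = g \<omega>) \<Longrightarrow> square_integrable M f \<longleftrightarrow> square_integrable M g"
  unfolding square_integrable_def by (simp cong: measurable_cong Bochner_Integration.integrable_cong)

lemma square_integrable_bound:
  assumes "square_integrable M g" "f \<in> borel_measurable M"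
    and "\<And>\<omega>. \<omega> \<in> space M \<Longrightarrow> norm (f \<omega>) \<le> norm (g \<omega>)"
  shows "square_integrable M f"
proof -
  have "integrable M (\<lambda>\<omega>. (norm (f \<omega>))\<^sup>2)"
  proof (rule Bochner_Integration.integrable_bound[OF square_integrable_norm_sq[OF assms(1)]])
    show "AE \<omega> in M. norm ((norm (f \<omega>))\<^sup>2) \<le> norm ((norm (g \<omega>))\<^sup>2)"
      using assms(3) by (intro AE_I2) (simp add: power_mono)
  qed (use assms(2) in measurable)
  then show ?thesis using assms(2) by (simp add: square_integrable_def)
qed

lemma square_integrable_add:
  assumes "square_integrable M f" "square_integrable M g"
  shows "square_integrable M (\<lambda>\<omega>. f \<omega> + g \<omega>)"
proof -
  note [measurable] = assms[THEN square_integrable_measurable]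
  have "integrable M (\<lambda>\<omega>. (norm (f \<omega> + g \<omega>))\<^sup>2)"
  proof (rule Bochner_Integration.integrable_bound)
    show "integrable M (\<lambda>\<omega>. 2 * (norm (f \<omega>))\<^sup>2 + 2 * (norm (g \<omega>))\<^sup>2)"
      using assms[THEN square_integrable_norm_sq] by simp
    have "(norm (u + v))\<^sup>2 \<le> 2 * (norm u)\<^sup>2 + 2 * (norm v)\<^sup>2" for u v :: 'b
    proof -
      have "(norm (u + v))\<^sup>2 + (norm (u - v))\<^sup>2 = 2 * (norm u)\<^sup>2 + 2 * (norm v)\<^sup>2"
        by (simp add: power2_norm_eq_inner algebra_simps)
      then show ?thesis using zero_le_power2[of "norm (u - v)"] by linarith
    qed
    then show "AE \<omega> in M. norm ((norm (f \<omega> + g \<omega>))\<^sup>2) \<le> norm (2 * (norm (f \<omega>))\<^sup>2 + 2 * (norm (g \<omega>))\<^sup>2)"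
      by (intro AE_I2) simp
  qed measurable
  then show ?thesis by (simp add: square_integrable_def)
qed

lemma square_integrable_scaleR:
  assumes "square_integrable M f"
  shows "square_integrable M (\<lambda>\<omega>. c *\<^sub>R f \<omega>)"
  using assms by (auto simp: square_integrable_def power_mult_distrib intro: borel_measurable_scaleR)

lemma square_integrable_diff:
  assumes "square_integrable M f" "square_integrable M g"
  shows "square_integrable M (\<lambda>\<omega>. f \<omega> - g \<omega>)"
  using square_integrable_add[OF assms(1) square_integrable_scaleR[OF assms(2), of "-1"]] by simp

lemma (in finite_measure) square_integrable_const: "square_integrable M (\<lambda>_. c)"
  by (simp add: square_integrable_def)

lemma (in finite_measure) square_integrable_sum:
  "(\<And>i. i \<in> I \<Longrightarrow> square_integrable M (f i)) \<Longrightarrow> square_integrable M (\<lambda>\<omega>. \<Sum>i\<in>I. f i \<omega>)"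
  by (induction I rule: infinite_finite_induct) (auto intro: square_integrable_const square_integrable_add)

lemma integrable_inner_square_integrable:
  assumes "square_integrable M f" "square_integrable M g"
  shows "integrable M (\<lambda>\<omega>. f \<omega> \<bullet> g \<omega>)"
proof (rule Bochner_Integration.integrable_bound)
  note [measurable] = assms[THEN square_integrable_measurable]
  show "(\<lambda>\<omega>. f \<omega> \<bullet> g \<omega>) \<in> borel_measurable M" by measurable
  show "integrable M (\<lambda>\<omega>. (norm (f \<omega>))\<^sup>2 + (norm (g \<omega>))\<^sup>2)"
    using assms[THEN square_integrable_norm_sq] by simp
  have "\<bar>u \<bullet> v\<bar> \<le> (norm u)\<^sup>2 + (norm v)\<^sup>2" for u v :: 'b
  proof -
    have "\<bar>u \<bullet> v\<bar> \<le> norm u * norm v" by (rule Cauchy_Schwarz_ineq2)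
    moreover have "2 * (norm u * norm v) \<le> (norm u)\<^sup>2 + (norm v)\<^sup>2"
      using sum_squares_bound[of "norm u" "norm v"] by (simp add: mult.assoc)
    ultimately show ?thesis using mult_nonneg_nonneg[OF norm_ge_zero norm_ge_zero, of u v] by linarith
  qed
  then show "AE \<omega> in M. norm (f \<omega> \<bullet> g \<omega>) \<le> norm ((norm (f \<omega>))\<^sup>2 + (norm (g \<omega>))\<^sup>2)"
    by (intro AE_I2) simp
qed

lemma borel_measurable_component:
  fixes f :: "'w \<Rightarrow> real^'n"
  assumes "f \<in> borel_measurable M"
  shows "(\<lambda>\<omega>. f \<omega> $ i) \<in> borel_measurable M"
  by (rule borel_measurable_continuous_on[OF _ assms]) (intro continuous_intros)

section \<open>Conditional expectations\<close>

lemma (in prob_space) sigma_finite_subalgebra_if_subalgebra: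
  "subalgebra M H \<Longrightarrow> sigma_finite_subalgebra M H"
  by (intro finite_measure_subalgebra_is_sigma_finite finite_measure_subalgebra.intro
      finite_measure_subalgebra_axioms.intro finite_measure_axioms)

text \<open>The tower property. In the nonnegative form it presupposes no integrability and can thus
  serve to establish that the noise is square-integrable.\<close>

lemma (in prob_space) nn_integral_le_if_nn_cond_exp_le:
  assumes "subalgebra M H" "f \<in> borel_measurable M" "AE \<omega> in M. nn_cond_exp M H f \<omega> \<le> c"
  shows "(\<integral>\<^sup>+\<omega>. f \<omega> \<partial>M) \<le> c"
proof -
  interpret sigma_finite_subalgebra M H
    by (rule sigma_finite_subalgebra_if_subalgebra[OF assms(1)])
  have "(\<integral>\<^sup>+\<omega>. f \<omega> \<partial>M) = (\<integral>\<^sup>+\<omega>. nn_cond_exp M H f \<omega> \<partial>M)"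
    using nn_cond_exp_intg[of "\<lambda>_. 1" f] assms(2) by simp
  also have "\<dots> \<le> (\<integral>\<^sup>+\<omega>. c \<partial>M)" by (intro nn_integral_mono_AE assms(3))
  also have "\<dots> = c" by (simp add: emeasure_space_1)
  finally show ?thesis .
qed

lemma square_integrable_if_nn_integral_le:
  assumes "f \<in> borel_measurable M" "(\<integral>\<^sup>+\<omega>. ennreal ((norm (f \<omega>))\<^sup>2) \<partial>M) \<le> ennreal c" "c \<ge> 0"
  shows "square_integrable M f" "(\<integral>\<omega>. (norm (f \<omega>))\<^sup>2 \<partial>M) \<le> c"
proof -
  have int: "integrable M (\<lambda>\<omega>. (norm (f \<omega>))\<^sup>2)"
    using assms(1,2) by (intro integrableI_nonneg) (auto intro: le_less_trans)
  then show "square_integrable M f" using assms(1) by (simp add: square_integrable_def)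
  show "(\<integral>\<omega>. (norm (f \<omega>))\<^sup>2 \<partial>M) \<le> c"
    using assms(2,3) nn_integral_eq_integral[OF int] by simp
qed

text \<open>In each coordinate the \<open>H\<close>-measurable factor \<open>u\<close> allows
  \<open>f\<close> to be replaced by its conditional expectation; square-integrability makes the
  products integrable.\<close>

lemma (in prob_space) integral_inner_eq_0_if_vec_cond_exp_eq_0:
  fixes f u :: "'a \<Rightarrow> real^'n"
  assumes H: "subalgebra M H" and f: "square_integrable M f" and u: "square_integrable M u"
    and uH: "u \<in> borel_measurable H" and ce: "AE \<omega> in M. vec_cond_exp M H f \<omega> = 0"
  shows "(\<integral>\<omega>. f \<omega> \<bullet> u \<omega> \<partial>M) = 0"
proof -
  interpret sigma_finite_subalgebra M H
    by (rule sigma_finite_subalgebra_if_subalgebra[OF H])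
  have comp: "square_integrable M (\<lambda>\<omega>. g \<omega> $ i)" if "square_integrable M g" for g :: "'a \<Rightarrow> real^'n" and i
    using that(1)
  proof (rule square_integrable_bound)
    show "(\<lambda>\<omega>. g \<omega> $ i) \<in> borel_measurable M"
      by (intro borel_measurable_component square_integrable_measurable that)
  qed (simp add: component_le_norm_cart)
  have int: "integrable M (\<lambda>\<omega>. u \<omega> $ i * f \<omega> $ i)" for i
    using integrable_inner_square_integrable[OF comp[OF u] comp[OF f], of i i] by simp
  have "(\<integral>\<omega>. u \<omega> $ i * f \<omega> $ i \<partial>M) = 0" for i
  proof -
    have "(\<integral>\<omega>. u \<omega> $ i * f \<omega> $ i \<partial>M) = (\<integral>\<omega>. u \<omega> $ i * real_cond_exp M H (\<lambda>\<omega>. f \<omega> $ i) \<omega> \<partial>M)"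
      by (intro real_cond_exp_intg(2)[symmetric] int borel_measurable_component
          square_integrable_measurable[OF f] uH)
    also have "\<dots> = (\<integral>\<omega>. 0 \<partial>M)"
      using ce by (intro integral_cong_AE)
        (use uH H in \<open>auto simp: vec_cond_exp_def vec_eq_iff intro!: borel_measurable_times borel_measurable_component intro: measurable_from_subalg\<close>)
    finally show ?thesis by simp
  qed
  then have "(\<Sum>i\<in>UNIV. \<integral>\<omega>. u \<omega> $ i * f \<omega> $ i \<partial>M) = 0" by simp
  then show ?thesis
    unfolding inner_vec_def using int by (simp add: mult.commute)
qed

section \<open>Integrability of the iterates\<close>

context VS_Ave
begin

lemma measurable_closest_point: "closest_point X \<in> borel_measurable borel"
  using y0_in by (intro borel_measurable_continuous_onI continuous_on_closest_point X_convex X_closed) auto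

text \<open>\<open>F\<close> is known to be continuous on \<open>X\<close> only. Composed with the
  projection it is continuous everywhere, and along \<open>z\<close> the projection changes
  nothing.\<close>

lemma measurable_F:
  assumes "z \<in> borel_measurable M" "\<And>\<omega>. \<omega> \<in> space M \<Longrightarrow> z \<omega> \<in> X"
  shows "(\<lambda>\<omega>. F (z \<omega>)) \<in> borel_measurable M"
proof -
  have "continuous_on UNIV (\<lambda>v. F (closest_point X v))"
    using y0_in X_closed closest_point_in_set[OF X_closed]
    by (intro continuous_on_compose2[OF lipschitz_on_continuous_on[OF F_lipschitz]]
        continuous_on_closest_point X_convex) auto
  then have "(\<lambda>\<omega>. F (closest_point X (z \<omega>))) \<in> borel_measurable M"
    by (rule borel_measurable_continuous_on[OF _ assms(1)])
  then show ?thesis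
    using assms(2) by (subst measurable_cong[where g = "\<lambda>\<omega>. F (closest_point X (z \<omega>))"])
      (auto simp: closest_point_self)
qed

lemma square_integrable_F:
  assumes "square_integrable M z" "\<And>\<omega>. \<omega> \<in> space M \<Longrightarrow> z \<omega> \<in> X"
  shows "square_integrable M (\<lambda>\<omega>. F (z \<omega>))"
proof -
  have "square_integrable M (\<lambda>\<omega>. F (z \<omega>) - F y0)"
  proof (rule square_integrable_bound)
    show "square_integrable M (\<lambda>\<omega>. L *\<^sub>R (z \<omega> - y0))"
      by (intro square_integrable_scaleR square_integrable_diff square_integrable_const assms)
    show "(\<lambda>\<omega>. F (z \<omega>) - F y0) \<in> borel_measurable M"
      using measurable_F[OF square_integrable_measurable[OF assms(1)] assms(2)] by simp
    show "norm (F (z \<omega>) - F y0) \<le> norm (L *\<^sub>R (z \<omega> - y0))" if "\<omega> \<in> space M" for \<omega>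
      using lipschitz[OF assms(2)[OF that] y0_in] L_pos by simp
  qed
  from square_integrable_add[OF this square_integrable_const[of "F y0"]] show ?thesis by simp
qed

lemma square_integrable_closest_point:
  assumes "square_integrable M u"
  shows "square_integrable M (\<lambda>\<omega>. closest_point X (u \<omega>))"
proof -
  have "square_integrable M (\<lambda>\<omega>. closest_point X (u \<omega>) - y0)"
  proof (rule square_integrable_bound)
    show "square_integrable M (\<lambda>\<omega>. u \<omega> - y0)"
      by (intro square_integrable_diff square_integrable_const assms)
    show "(\<lambda>\<omega>. closest_point X (u \<omega>) - y0) \<in> borel_measurable M"
      using measurable_compose[OF square_integrable_measurable[OF assms] measurable_closest_point] by simp
    show "norm (closest_point X (u \<omega>) - y0) \<le> norm (u \<omega> - y0)" for \<omega>
      using closest_point_lipschitz[OF X_convex X_closed, of "u \<omega>" y0] y0_in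
      by (auto simp: dist_norm closest_point_self)
  qed
  from square_integrable_add[OF this square_integrable_const[of y0]] show ?thesis by simp
qed

end

context VS_Ave_noise
begin

text \<open>\<open>x k\<close> depends on all \<open>y i\<close> with \<open>i \<le> k\<close>, and
  \<open>y (Suc k)\<close> on \<open>x k\<close>. Treating \<open>x\<close> relative to
  \<open>y\<close> reduces the mutual recursion to one strong induction on \<open>y\<close>.\<close>

lemma x_y_measurable: "x k \<in> borel_measurable M" "y k \<in> borel_measurable M"
proof -
  have x: "x k \<in> borel_measurable M" if "\<And>i. i \<le> k \<Longrightarrow> y i \<in> borel_measurable M" for k
  proof -
    have "(\<lambda>\<omega>. F (y i \<omega>)) \<in> borel_measurable M" if "i \<le> k" for i
      using measurable_F y_in that \<open>\<And>i. i \<le> k \<Longrightarrow> y i \<in> borel_measurable M\<close> by simp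
    then have "(\<lambda>\<omega>. (1 / (\<Sum>i\<le>k. gam \<mu> L i)) *\<^sub>R
        (\<Sum>i\<le>k. gam \<mu> L i *\<^sub>R (y i \<omega> - (1/\<mu>) *\<^sub>R (F (y i \<omega>) + noise_y i \<omega>)))) \<in> borel_measurable M"
      using noise_y_rv that
      by (intro borel_measurable_scaleR borel_measurable_sum borel_measurable_diff borel_measurable_add
          borel_measurable_const) auto
    from measurable_compose[OF this measurable_closest_point] show ?thesis
      by (rule subst[OF measurable_cong, rotated 1]) (simp add: x_step)
  qed
  have y: "y k \<in> borel_measurable M" for k
  proof (induction k rule: less_induct)
    case (less k)
    show ?case
    proof (cases k)
      case 0
      have "y 0 \<in> borel_measurable M \<longleftrightarrow> (\<lambda>_. y0) \<in> borel_measurable M"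
        by (rule measurable_cong) (rule y_0)
      then show ?thesis using 0 by simp
    next
      case (Suc j)
      have xj: "x j \<in> borel_measurable M" using Suc by (intro x less) simp
      have "(\<lambda>\<omega>. x j \<omega> - (1/L) *\<^sub>R (F (x j \<omega>) + noise_x j \<omega>)) \<in> borel_measurable M"
        using xj noise_x_rv measurable_F[OF xj x_in] by simp
      from measurable_compose[OF this measurable_closest_point] show ?thesis
        unfolding Suc by (rule subst[OF measurable_cong, rotated 1]) (simp add: y_step)
    qed
  qed
  show "x k \<in> borel_measurable M" "y k \<in> borel_measurable M" using x y by auto
qed

section \<open>The history as a sub-sigma-algebra\<close>

lemma sets_sigma_upto:
  "sets (sigma_upto M z k) = sigma_sets (space M) (\<Union>i<k. {z i -` A \<inter> space M |A. A \<in> sets borel})"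
  unfolding sigma_upto_def by (rule sets_measure_of) auto

lemma sigma_upto_subset:
  assumes "\<And>i. z i \<in> borel_measurable M"
  shows "sets (sigma_upto M z k) \<subseteq> sets M"
  unfolding sets_sigma_upto using assms by (intro sets.sigma_sets_subset) (auto dest: measurable_sets)

lemma sets_history:
  "sets (history M y x k) = sigma_sets (space M) (sets (sigma_upto M y k) \<union> sets (sigma_upto M x (k - 1)))"
  unfolding history_def using sigma_upto_subset x_y_measurable sets.space_closed[of M]
  by (intro sets_measure_of) blast

lemma subalgebra_history: "subalgebra M (history M y x k)"
  unfolding subalgebra_def
proof
  show "space (history M y x k) = space M" by (simp add: history_def space_measure_of_conv)
  show "sets (history M y x k) \<subseteq> sets M"
    unfolding sets_history using sigma_upto_subset x_y_measurable
    by (intro sets.sigma_sets_subset) blast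
qed

text \<open>The last \<open>x\<close>-iterate generating \<open>history M y x k\<close> is the one
  with index \<open>k - 2\<close>; this bound fixes the length of the lag.\<close>

lemma x_history_measurable:
  assumes "j + 1 < k"
  shows "x j \<in> borel_measurable (history M y x k)"
proof (rule measurableI)
  fix A :: "(real^'n) set" assume "A \<in> sets borel"
  then have "x j -` A \<inter> space M \<in> sets (sigma_upto M x (k - 1))"
    unfolding sets_sigma_upto using assms by (intro sigma_sets.Basic UN_I[of j]) auto
  moreover have "space (history M y x k) = space M" by (simp add: history_def space_measure_of_conv)
  ultimately show "x j -` A \<inter> space (history M y x k) \<in> sets (history M y x k)"
    unfolding sets_history by (auto intro: sigma_sets.Basic)
qed simp

section \<open>Second moments of the noise and the iterates\<close>

lemma noise_y_square_integrable:
  "square_integrable M (noise_y k)" "(\<integral>\<omega>. (norm (noise_y k \<omega>))\<^sup>2 \<partial>M) \<le> \<nu>\<^sup>2 / real (N k)"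
proof -
  have *: "(\<integral>\<^sup>+\<omega>. ennreal ((norm (noise_y k \<omega>))\<^sup>2) \<partial>M) \<le> ennreal (\<nu>\<^sup>2 / real (N k))"
  proof (cases k)
    case 0
    then show ?thesis using noise_y_0_bound by simp
  next
    case (Suc j)
    have "AE \<omega> in M. nn_cond_exp M (history M y x j) (\<lambda>\<omega>. ennreal ((norm (noise_y k \<omega>))\<^sup>2)) \<omega>
        \<le> ennreal (\<nu>\<^sup>2 / real (N k))"
      using noise unfolding Suc by (auto elim!: eventually_mono)
    then show ?thesis
      using noise_y_rv[of k] by (intro nn_integral_le_if_nn_cond_exp_le[OF subalgebra_history]) measurable
  qed
  show "square_integrable M (noise_y k)" "(\<integral>\<omega>. (norm (noise_y k \<omega>))\<^sup>2 \<partial>M) \<le> \<nu>\<^sup>2 / real (N k)"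
    using square_integrable_if_nn_integral_le[OF noise_y_rv *] by simp_all
qed

lemma noise_x_square_integrable:
  "square_integrable M (noise_x k)" "(\<integral>\<omega>. (norm (noise_x k \<omega>))\<^sup>2 \<partial>M) \<le> \<nu>'\<^sup>2 / real (N k)"
proof -
  have "AE \<omega> in M. nn_cond_exp M (history M y x k) (\<lambda>\<omega>. ennreal ((norm (noise_x k \<omega>))\<^sup>2)) \<omega>
      \<le> ennreal (\<nu>'\<^sup>2 / real (N k))"
    using noise by (auto elim!: eventually_mono)
  then have *: "(\<integral>\<^sup>+\<omega>. ennreal ((norm (noise_x k \<omega>))\<^sup>2) \<partial>M) \<le> ennreal (\<nu>'\<^sup>2 / real (N k))"
    using noise_x_rv[of k] by (intro nn_integral_le_if_nn_cond_exp_le[OF subalgebra_history]) measurable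
  show "square_integrable M (noise_x k)" "(\<integral>\<omega>. (norm (noise_x k \<omega>))\<^sup>2 \<partial>M) \<le> \<nu>'\<^sup>2 / real (N k)"
    using square_integrable_if_nn_integral_le[OF noise_x_rv *] by simp_all
qed

text \<open>Needed so that the products of noise and iterates are integrable. The induction is that
  of \<open>x_y_measurable\<close>; \<open>F\<close> and the projection preserve
  square-integrability by their Lipschitz bounds around \<open>y0\<close>.\<close>

lemma x_y_square_integrable: "square_integrable M (x k)" "square_integrable M (y k)"
proof -
  have x: "square_integrable M (x k)" if "\<And>i. i \<le> k \<Longrightarrow> square_integrable M (y i)" for k
    by (rule iffD2[OF square_integrable_cong[OF x_step]])
      (auto intro!: square_integrable_closest_point square_integrable_scaleR square_integrable_sum
        square_integrable_diff square_integrable_add square_integrable_F noise_y_square_integrable(1) that y_in)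
  have y: "square_integrable M (y k)" for k
  proof (induction k rule: less_induct)
    case (less k)
    show ?case
    proof (cases k)
      case 0
      show ?thesis unfolding 0
        by (rule iffD2[OF square_integrable_cong[OF y_0]]) (simp_all add: square_integrable_const)
    next
      case (Suc j)
      have "square_integrable M (x j)" using Suc by (intro x less) simp
      then show ?thesis unfolding Suc
        by (intro iffD2[OF square_integrable_cong[OF y_step]])
          (auto intro!: square_integrable_closest_point square_integrable_scaleR
            square_integrable_diff square_integrable_add square_integrable_F noise_x_square_integrable(1) x_in)
    qed
  qed
  show "square_integrable M (x k)" "square_integrable M (y k)" using x y by auto
qed

lemma averaged_output_square_integrable: "square_integrable M (averaged_output \<mu> L y K)"
  unfolding averaged_output_def
  by (intro square_integrable_scaleR square_integrable_sum x_y_square_integrable)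

end

section \<open>Expected error\<close>

text \<open>Young's inequality that moves weight from a later step size \<open>h\<close> to an
  earlier one \<open>g\<close>, their ratio being at most \<open>\<beta>\<close>. Its parameter
  \<open>3 * \<beta> / \<mu>\<close> is chosen to leave the share \<open>\<mu> / 6\<close> on the
  increment \<open>v\<close>.\<close>

lemma inner_le_weighted:
  fixes u v :: "'a::real_inner"
  assumes "\<mu> > 0" "\<beta> > 0" "h \<ge> 0" "h \<le> \<beta> * g"
  shows "h * (u \<bullet> v) \<le> 3 * \<beta> / (2 * \<mu>) * h * (norm u)\<^sup>2 + \<mu> / 6 * g * (norm v)\<^sup>2"
proof -
  have "u \<bullet> v \<le> 3 * \<beta> / \<mu> / 2 * (norm u)\<^sup>2 + 1 / (2 * (3 * \<beta> / \<mu>)) * (norm v)\<^sup>2"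
    using assms by (intro inner_le_Young) simp
  then have "h * (u \<bullet> v) \<le> h * (3 * \<beta> / \<mu> / 2 * (norm u)\<^sup>2 + 1 / (2 * (3 * \<beta> / \<mu>)) * (norm v)\<^sup>2)"
    using assms by (intro mult_left_mono) auto
  also have "\<dots> = 3 * \<beta> / (2 * \<mu>) * h * (norm u)\<^sup>2 + \<mu> / 6 * (h / \<beta>) * (norm v)\<^sup>2"
    using assms by (simp add: field_simps)
  also have "\<mu> / 6 * (h / \<beta>) * (norm v)\<^sup>2 \<le> \<mu> / 6 * g * (norm v)\<^sup>2"
    using assms by (intro mult_right_mono mult_left_mono) (auto simp: field_simps)
  finally show ?thesis by simp
qed

context VS_Ave
begin

text \<open>Prepending \<open>x_start\<close> makes truncated subtraction harmless:
  \<open>shifted_x (k - 2)\<close> is deterministic for \<open>k \<le> 2\<close> and equals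
  \<open>x (k - 3)\<close> afterwards.\<close>

definition shifted_x :: "nat \<Rightarrow> 'w \<Rightarrow> real^'n" where
  "shifted_x k \<omega> = (case k of 0 \<Rightarrow> x_start | Suc j \<Rightarrow> x j \<omega>)"

lemma shifted_x_simps [simp]: "shifted_x 0 \<omega> = x_start" "shifted_x (Suc j) \<omega> = x j \<omega>"
  by (simp_all add: shifted_x_def)

definition incr :: "nat \<Rightarrow> 'w \<Rightarrow> real^'n" where
  "incr k \<omega> = shifted_x (Suc k) \<omega> - shifted_x k \<omega>"

text \<open>The \<open>\<sigma>\<close>-algebra that the noise at \<open>y\<^sub>k\<^sub>+\<^sub>1\<close> is conditioned on knows the \<open>x\<close>-iterates only up
  to \<open>x\<^sub>k\<^sub>-\<^sub>2\<close>. So in the term \<open>noise_y (k + 1) \<bullet> (p - x\<^sub>k\<^sub>+\<^sub>1)\<close> only \<open>p - x\<^sub>k\<^sub>-\<^sub>2\<close> averages out; the three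
  remaining increments are absorbed by the negative squares in \<open>merit_step\<close>.\<close>

lemma lagged_noise_le:
  assumes "\<mu> \<le> L"
  shows "gam \<mu> L (Suc k) * (noise_y (Suc k) \<omega> \<bullet> (shifted_x (k - 1) \<omega> - x (Suc k) \<omega>))
    \<le> 57 / (8 * \<mu>) * gam \<mu> L (Suc k) * (norm (noise_y (Suc k) \<omega>))\<^sup>2
      + \<mu> / 6 * (gam \<mu> L (Suc k) * (norm (incr (Suc k) \<omega>))\<^sup>2 + gam \<mu> L k * (norm (incr k \<omega>))\<^sup>2
        + gam \<mu> L (k - 1) * (norm (incr (k - 1) \<omega>))\<^sup>2)"
proof -
  let ?w = "noise_y (Suc k) \<omega>" and ?g = "gam \<mu> L"
  let ?G = "?g (Suc k)" and ?S = "(norm (noise_y (Suc k) \<omega>))\<^sup>2"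
  define b where "b = 1 + \<mu> / (\<mu> + L)"
  have b: "b > 0" "b \<le> 3 / 2" using assms \<mu>_pos L_pos by (auto simp: b_def field_simps add_pos_pos)
  have g_nn: "?g j \<ge> 0" for j using gam_pos[OF \<mu>_pos L_pos] less_imp_le by blast
  have ratio: "?g (Suc j) \<le> b * ?g j" for j using gam_Suc_le[OF \<mu>_pos L_pos] by (simp only: b_def)
  \<comment> \<open>Going back 0, 1 or 2 indices costs the ratio 1, \<open>b\<close> or
    \<open>b\<^sup>2\<close>, so that each increment is weighted by its own step size.\<close>
  have e0: "?G * (?w \<bullet> (- incr (Suc k) \<omega>)) \<le> 3 * 1 / (2 * \<mu>) * ?G * ?S + \<mu> / 6 * ?G * (norm (- incr (Suc k) \<omega>))\<^sup>2"
    by (intro inner_le_weighted \<mu>_pos g_nn) auto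
  have e1: "?G * (?w \<bullet> (- incr k \<omega>)) \<le> 3 * b / (2 * \<mu>) * ?G * ?S + \<mu> / 6 * ?g k * (norm (- incr k \<omega>))\<^sup>2"
    by (intro inner_le_weighted \<mu>_pos g_nn b ratio)
  \<comment> \<open>For \<open>k = 0\<close> only two increments lie between \<open>x_start\<close>
    and \<open>x 1\<close>; without the \<open>if\<close>, \<open>incr 0\<close> would be counted
    twice.\<close>
  have e2: "(if k = 0 then 0 else ?G * (?w \<bullet> (- incr (k - 1) \<omega>)))
      \<le> 3 * b\<^sup>2 / (2 * \<mu>) * ?G * ?S + \<mu> / 6 * ?g (k - 1) * (norm (- incr (k - 1) \<omega>))\<^sup>2"
  proof (cases k)
    case 0
    have "0 \<le> 3 * b\<^sup>2 / (2 * \<mu>) * ?G * ?S" "0 \<le> \<mu> / 6 * ?g (k - 1) * (norm (- incr (k - 1) \<omega>))\<^sup>2"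
      using \<mu>_pos g_nn by (intro mult_nonneg_nonneg; simp del: gam.simps(2))+
    then show ?thesis using 0 by simp
  next
    case (Suc j)
    have "?G \<le> b * ?g k" by (rule ratio)
    also have "\<dots> \<le> b * (b * ?g j)" using ratio[of j] b unfolding Suc by (intro mult_left_mono) auto
    finally have "?G \<le> b\<^sup>2 * ?g (k - 1)" using Suc by (simp add: power2_eq_square)
    then have "?G * (?w \<bullet> (- incr (k - 1) \<omega>))
        \<le> 3 * b\<^sup>2 / (2 * \<mu>) * ?G * ?S + \<mu> / 6 * ?g (k - 1) * (norm (- incr (k - 1) \<omega>))\<^sup>2"
      using b by (intro inner_le_weighted \<mu>_pos g_nn) auto
    then show ?thesis using Suc by simp
  qed
  have "?G * (?w \<bullet> (shifted_x (k - 1) \<omega> - x (Suc k) \<omega>))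
      = ?G * (?w \<bullet> (- incr (Suc k) \<omega>)) + ?G * (?w \<bullet> (- incr k \<omega>))
        + (if k = 0 then 0 else ?G * (?w \<bullet> (- incr (k - 1) \<omega>)))"
    by (cases k) (simp_all add: incr_def inner_diff_right algebra_simps del: gam.simps(2))
  also have "\<dots> \<le> (1 + b + b\<^sup>2) * (3 / (2 * \<mu>) * ?G * ?S)
      + \<mu> / 6 * (?G * (norm (incr (Suc k) \<omega>))\<^sup>2 + ?g k * (norm (incr k \<omega>))\<^sup>2
        + ?g (k - 1) * (norm (incr (k - 1) \<omega>))\<^sup>2)"
    using e0 e1 e2 unfolding norm_minus_cancel
    by (simp add: algebra_simps add_divide_distrib del: gam.simps(2))
  \<comment> \<open>19/4 is 1 + 3/2 + 9/4, from \<open>b \<le> 3 / 2\<close>; multiplied by 3/2 it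
    gives 57/8.\<close>
  also have "(1 + b + b\<^sup>2) * (3 / (2 * \<mu>) * ?G * ?S) \<le> 19 / 4 * (3 / (2 * \<mu>) * ?G * ?S)"
  proof (rule mult_right_mono)
    have "b\<^sup>2 \<le> (3 / 2)\<^sup>2" using b by (intro power_mono) auto
    then show "1 + b + b\<^sup>2 \<le> 19 / 4" using b by (simp add: power2_eq_square)
    show "0 \<le> 3 / (2 * \<mu>) * ?G * ?S" using \<mu>_pos g_nn by (intro mult_nonneg_nonneg; simp del: gam.simps(2))
  qed
  finally show ?thesis by (simp add: field_simps del: gam.simps(2))
qed

lemma merit_le_sum:
  assumes \<omega>: "\<omega> \<in> space M" and \<mu>L: "\<mu> \<le> L"
  shows "merit p K \<omega> (x K \<omega>) \<le> (L / \<mu>)\<^sup>2 * gap_function \<mu> X F y0 + 3 / (2 * \<mu>) * (norm (noise_y 0 \<omega>))\<^sup>2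
    + (\<Sum>k\<le>K. gam \<mu> L k * (noise_y k \<omega> \<bullet> (p - shifted_x (k - 2) \<omega>)))
    + (\<Sum>k<K. gam \<mu> L (Suc k) *
        (57 / (8 * \<mu>) * (norm (noise_y (Suc k) \<omega>))\<^sup>2 + 1 / (2 * \<mu>) * (norm (noise_x k \<omega>))\<^sup>2))"
    (is "_ \<le> ?R K")
proof -
  let ?g = "gam \<mu> L"
  have g_nn: "?g j \<ge> 0" for j using gam_pos[OF \<mu>_pos L_pos] less_imp_le by blast
  \<comment> \<open>The induction carries the unspent reserves: the newest increment has been
    charged once out of three times, the previous one twice.\<close>
  have "merit p K \<omega> (x K \<omega>) + \<mu> / 3 * (?g K * (norm (incr K \<omega>))\<^sup>2)
      + \<mu> / 6 * (?g (K - 1) * (norm (incr (K - 1) \<omega>))\<^sup>2) \<le> ?R K"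
  proof (induction K)
    case 0
    \<comment> \<open>As \<open>0 - 1 = 0\<close>, both reserves fall on \<open>incr 0\<close> and
      add up to \<open>\<mu> / 2\<close>. No \<open>merit_step\<close> provides them, so they are
      bought with squared noise: \<open>1 / \<mu>\<close> for the correlation and
      \<open>1 / (2 * \<mu>)\<close> for the reserve make \<open>3 / (2 * \<mu>)\<close>.\<close>
    let ?w = "noise_y 0 \<omega>" and ?d = "x 0 \<omega> - x_start"
    have d: "norm ?d \<le> norm ?w / \<mu>" by (rule x_0_near_start[OF \<omega>])
    have "?w \<bullet> (x_start - x 0 \<omega>) \<le> norm ?w * norm (x_start - x 0 \<omega>)" by (rule norm_cauchy_schwarz)
    also have "norm (x_start - x 0 \<omega>) = norm ?d" by (rule norm_minus_commute)
    also have "norm ?w * norm ?d \<le> norm ?w * (norm ?w / \<mu>)" using d by (intro mult_left_mono) auto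
    finally have 1: "?w \<bullet> (x_start - x 0 \<omega>) \<le> (norm ?w)\<^sup>2 / \<mu>" by (simp add: power2_eq_square)
    have "\<mu> / 2 * (norm ?d)\<^sup>2 \<le> \<mu> / 2 * (norm ?w / \<mu>)\<^sup>2"
      using d \<mu>_pos by (intro mult_left_mono power_mono) auto
    also have "\<dots> = (norm ?w)\<^sup>2 / (2 * \<mu>)" using \<mu>_pos by (simp add: power2_eq_square)
    finally have 2: "\<mu> / 2 * (norm ?d)\<^sup>2 \<le> (norm ?w)\<^sup>2 / (2 * \<mu>)" .
    have 3: "3 / (2 * \<mu>) * (norm ?w)\<^sup>2 = (norm ?w)\<^sup>2 / \<mu> + (norm ?w)\<^sup>2 / (2 * \<mu>)"
      using \<mu>_pos by (simp add: field_simps)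
    have 4: "?w \<bullet> (p - x 0 \<omega>) = ?w \<bullet> (p - x_start) + ?w \<bullet> (x_start - x 0 \<omega>)"
      by (simp add: inner_diff_right)
    have 5: "\<mu> / 3 * (?g 0 * (norm (incr 0 \<omega>))\<^sup>2) + \<mu> / 6 * (?g (0 - 1) * (norm (incr (0 - 1) \<omega>))\<^sup>2)
        = \<mu> / 2 * (norm ?d)\<^sup>2"
      by (simp add: incr_def)
    have "?R 0 = (L / \<mu>)\<^sup>2 * gap_function \<mu> X F y0 + 3 / (2 * \<mu>) * (norm ?w)\<^sup>2 + ?w \<bullet> (p - x_start)"
      by simp
    then show ?case using merit_0_le[OF \<omega>, of p] 1 2 3 4 5 by linarith
  next
    case (Suc K)
    let ?w = "noise_y (Suc K) \<omega>"
    have "?w \<bullet> (p - x (Suc K) \<omega>)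
        = ?w \<bullet> (p - shifted_x (K - 1) \<omega>) + ?w \<bullet> (shifted_x (K - 1) \<omega> - x (Suc K) \<omega>)"
      by (simp add: inner_diff_right)
    moreover have "x (Suc K) \<omega> - x K \<omega> = incr (Suc K) \<omega>" by (simp add: incr_def)
    ultimately have "merit p (Suc K) \<omega> (x (Suc K) \<omega>) \<le> merit p K \<omega> (x K \<omega>) +
      ?g (Suc K) * (?w \<bullet> (p - shifted_x (K - 1) \<omega>)) + ?g (Suc K) * (?w \<bullet> (shifted_x (K - 1) \<omega> - x (Suc K) \<omega>))
      + ?g (Suc K) * (1 / (2 * \<mu>) * (norm (noise_x K \<omega>))\<^sup>2) - \<mu> / 2 * (?g (Suc K) * (norm (incr (Suc K) \<omega>))\<^sup>2)"
      using merit_step[OF \<omega>, of p K] by (simp add: algebra_simps del: gam.simps(2))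
    then show ?case
      using lagged_noise_le[OF \<mu>L, of K \<omega>] Suc.IH
      by (simp add: algebra_simps add_divide_distrib del: gam.simps(2))
  qed
  moreover have "0 \<le> \<mu> / 3 * (?g K * (norm (incr K \<omega>))\<^sup>2)"
    "0 \<le> \<mu> / 6 * (?g (K - 1) * (norm (incr (K - 1) \<omega>))\<^sup>2)"
    using \<mu>_pos g_nn by auto
  ultimately show ?thesis by linarith
qed

end

context VS_Ave_noise
begin

lemma shifted_x_square_integrable: "square_integrable M (shifted_x k)"
proof (cases k)
  case 0
  then show ?thesis by (simp add: shifted_x_def[abs_def] square_integrable_const)
next
  case (Suc j)
  then show ?thesis using x_y_square_integrable(1)[of j] by (simp add: shifted_x_def[abs_def])
qed

text \<open>For \<open>k = Suc j\<close> the noise is centred given \<open>history M y x j\<close>,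
  and \<open>shifted_x (j - 1)\<close> is the latest iterate known to be measurable there. For
  \<open>k = 0\<close> the second factor is constant and the plain mean suffices.\<close>

lemma noise_y_orthogonal: "(\<integral>\<omega>. noise_y k \<omega> \<bullet> (p - shifted_x (k - 2) \<omega>) \<partial>M) = 0"
proof (cases k)
  case 0
  have "integrable M (noise_y 0)"
  proof (rule Bochner_Integration.integrable_bound)
    show "integrable M (\<lambda>\<omega>. 1 + (norm (noise_y 0 \<omega>))\<^sup>2)"
      using square_integrable_norm_sq[OF noise_y_square_integrable(1)] by simp
    have "t \<le> 1 + t\<^sup>2" for t :: real
    proof -
      have "2 * t \<le> t\<^sup>2 + 1" using sum_squares_bound[of t 1] by simp
      then show ?thesis using zero_le_power2[of t] by linarith
    qed
    then show "AE \<omega> in M. norm (noise_y 0 \<omega>) \<le> norm (1 + (norm (noise_y 0 \<omega>))\<^sup>2)"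
      by (intro AE_I2) simp
  qed (rule noise_y_rv)
  then show ?thesis using 0 noise_y_0_mean by (simp add: shifted_x_def)
next
  case (Suc j)
  have "shifted_x (j - 1) \<in> borel_measurable (history M y x j)"
  proof (cases "j - 1")
    case 0
    then show ?thesis by (simp add: shifted_x_def[abs_def])
  next
    case (Suc i)
    then show ?thesis using x_history_measurable[of i j] by (simp add: shifted_x_def[abs_def])
  qed
  then show ?thesis
    using noise unfolding Suc
    by (intro integral_inner_eq_0_if_vec_cond_exp_eq_0[OF subalgebra_history[of j]]
        noise_y_square_integrable square_integrable_diff square_integrable_const)
      (auto elim!: eventually_mono intro: shifted_x_square_integrable)
qed

lemma expected_error_le:
  assumes p: "VI_solution X F p" and \<mu>L: "\<mu> \<le> L"
  shows "\<mu> / 2 * Gam \<mu> L K * (\<integral>\<omega>. (norm (averaged_output \<mu> L y K \<omega> - p))\<^sup>2 \<partial>M)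
    \<le> (L / \<mu>)\<^sup>2 * gap_function \<mu> X F y0 + 3 / (2 * \<mu>) * (\<nu>\<^sup>2 / real (N 0))
      + (\<Sum>k<K. gam \<mu> L (Suc k) *
          (57 / (8 * \<mu>) * (\<nu>\<^sup>2 / real (N (Suc k))) + 1 / (2 * \<mu>) * (\<nu>'\<^sup>2 / real (N k))))"
proof -
  define cross where "cross k \<omega> = noise_y k \<omega> \<bullet> (p - shifted_x (k - 2) \<omega>)" for k \<omega>
  have cross: "integrable M (cross k)" "(\<integral>\<omega>. cross k \<omega> \<partial>M) = 0" for k
    unfolding cross_def using noise_y_orthogonal
    by (auto intro!: integrable_inner_square_integrable noise_y_square_integrable square_integrable_diff
        square_integrable_const shifted_x_square_integrable)
  note int = square_integrable_norm_sq[OF noise_y_square_integrable(1)]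
    square_integrable_norm_sq[OF noise_x_square_integrable(1)]
  define R where "R \<omega> = (L / \<mu>)\<^sup>2 * gap_function \<mu> X F y0 + 3 / (2 * \<mu>) * (norm (noise_y 0 \<omega>))\<^sup>2
    + (\<Sum>k\<le>K. gam \<mu> L k * cross k \<omega>)
    + (\<Sum>k<K. gam \<mu> L (Suc k) *
        (57 / (8 * \<mu>) * (norm (noise_y (Suc k) \<omega>))\<^sup>2 + 1 / (2 * \<mu>) * (norm (noise_x k \<omega>))\<^sup>2))" for \<omega>
  have intR: "integrable M R" unfolding R_def
    by (intro Bochner_Integration.integrable_add Bochner_Integration.integrable_sum integrable_mult_right
        int cross integrable_const)
  have "\<mu> / 2 * Gam \<mu> L K * (\<integral>\<omega>. (norm (averaged_output \<mu> L y K \<omega> - p))\<^sup>2 \<partial>M)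
      = (\<integral>\<omega>. \<mu> / 2 * Gam \<mu> L K * (norm (averaged_output \<mu> L y K \<omega> - p))\<^sup>2 \<partial>M)"
    by simp
  also have "\<dots> \<le> (\<integral>\<omega>. R \<omega> \<partial>M)"
  proof (rule integral_mono[OF _ intR])
    show "integrable M (\<lambda>\<omega>. \<mu> / 2 * Gam \<mu> L K * (norm (averaged_output \<mu> L y K \<omega> - p))\<^sup>2)"
      by (intro integrable_mult_right square_integrable_norm_sq square_integrable_diff
          averaged_output_square_integrable square_integrable_const)
    show "\<mu> / 2 * Gam \<mu> L K * (norm (averaged_output \<mu> L y K \<omega> - p))\<^sup>2 \<le> R \<omega>" if "\<omega> \<in> space M" for \<omega>
      using merit_solution_ge[OF that p, of K] merit_le_sum[OF that \<mu>L, of p K]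
      unfolding R_def cross_def by linarith
  qed
  also have "\<dots> = (L / \<mu>)\<^sup>2 * gap_function \<mu> X F y0 + 3 / (2 * \<mu>) * (\<integral>\<omega>. (norm (noise_y 0 \<omega>))\<^sup>2 \<partial>M)
    + (\<Sum>k<K. gam \<mu> L (Suc k) * (57 / (8 * \<mu>) * (\<integral>\<omega>. (norm (noise_y (Suc k) \<omega>))\<^sup>2 \<partial>M)
        + 1 / (2 * \<mu>) * (\<integral>\<omega>. (norm (noise_x k \<omega>))\<^sup>2 \<partial>M)))"
    unfolding R_def
    by (simp add: int cross prob_space del: gam.simps(2))
  also have "\<dots> \<le> (L / \<mu>)\<^sup>2 * gap_function \<mu> X F y0 + 3 / (2 * \<mu>) * (\<nu>\<^sup>2 / real (N 0))
      + (\<Sum>k<K. gam \<mu> L (Suc k) *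
          (57 / (8 * \<mu>) * (\<nu>\<^sup>2 / real (N (Suc k))) + 1 / (2 * \<mu>) * (\<nu>'\<^sup>2 / real (N k))))"
    using \<mu>_pos less_imp_le[OF gam_pos[OF \<mu>_pos L_pos]]
    by (intro add_mono sum_mono mult_left_mono noise_y_square_integrable noise_x_square_integrable order_refl)
      (auto simp del: gam.simps(2))
  finally show ?thesis .
qed

end

section \<open>Linear rate\<close>

text \<open>Rounding down a number that is at least 1 loses at most half of it, hence the factor
  2.\<close>

lemma sample_size_bounds:
  assumes "0 < \<rho>" "\<rho> < 1"
  shows "real (sample_size \<rho> k) \<le> (1 / \<rho>) ^ k" "1 / real (sample_size \<rho> k) \<le> 2 * \<rho> ^ k"
proof -
  define s where "s = (1 / \<rho>) ^ k"
  have s: "s \<ge> 1" unfolding s_def using assms by (intro one_le_power) simp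
  have "\<rho> powi (- int k) = s" by (simp add: s_def power_int_minus power_one_over inverse_eq_divide)
  then have N: "real (sample_size \<rho> k) = of_int \<lfloor>s\<rfloor>" using s by (simp add: sample_size_def)
  then show "real (sample_size \<rho> k) \<le> (1 / \<rho>) ^ k" by (simp add: s_def[symmetric])
  have "of_int \<lfloor>s\<rfloor> \<ge> (1::real)" using s by simp
  moreover have "s < of_int \<lfloor>s\<rfloor> + 1" by linarith
  ultimately have "s / 2 \<le> of_int \<lfloor>s\<rfloor>" by linarith
  then have "1 / of_int \<lfloor>s\<rfloor> \<le> 1 / (s / 2)" using s by (intro divide_left_mono mult_pos_pos) auto
  also have "\<dots> = 2 * \<rho> ^ k" by (simp add: s_def power_one_over)
  finally show "1 / real (sample_size \<rho> k) \<le> 2 * \<rho> ^ k" by (simp add: N)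
qed

text \<open>Step sizes grow by \<open>1 + a\<close> and variances decay by \<open>\<rho>\<close>, so
  the sum is geometric with ratio \<open>r < 1\<close>. Since \<open>a \<le> 1 / 2\<close>, the
  coefficient \<open>57 / 4 * (a / (1 + a))\<close> is at most 19/4; 6 covers it together with the
  other two.\<close>

lemma noise_sum_le:
  assumes pos: "\<mu> > 0" "\<mu> \<le> L" and \<rho>: "0 < \<rho>" "\<rho> < 1" "\<rho> * (1 + \<mu> / (\<mu> + L)) < 1"
  shows "3 / (2 * \<mu>) * (\<nu>\<^sup>2 / real (sample_size \<rho> 0)) + (\<Sum>k<K. gam \<mu> L (Suc k) *
          (57 / (8 * \<mu>) * (\<nu>\<^sup>2 / real (sample_size \<rho> (Suc k))) + 1 / (2 * \<mu>) * (\<nu>'\<^sup>2 / real (sample_size \<rho> k))))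
    \<le> 6 / \<mu> * (\<nu>\<^sup>2 + \<nu>'\<^sup>2) / (1 - \<rho> * (1 + \<mu> / (\<mu> + L)))" (is "?w0 + (\<Sum>k<K. ?t k) \<le> _")
proof -
  define a where "a = \<mu> / (\<mu> + L)"
  define r where "r = \<rho> * (1 + a)"
  have a: "a > 0" "a \<le> 1 / 2" using pos by (auto simp: a_def field_simps)
  have r: "0 < r" "r < 1" using a \<rho> by (auto simp: r_def a_def)
  have w0: "?w0 \<le> 6 / \<mu> * \<nu>\<^sup>2"
    using pos by (simp add: sample_size_def field_simps)
  have t: "?t k \<le> 6 / \<mu> * (\<nu>\<^sup>2 * r ^ Suc k + \<nu>'\<^sup>2 * r ^ k)" for k
  proof -
    have gam: "gam \<mu> L (Suc k) = a * (1 + a) ^ k" by (simp only: gam_Suc_eq_power a_def)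
    have n: "s\<^sup>2 / real (sample_size \<rho> j) \<le> s\<^sup>2 * (2 * \<rho> ^ j)" for s j
      using mult_left_mono[OF sample_size_bounds(2)[OF \<rho>(1,2)], of "s\<^sup>2" j] by simp
    have "?t k \<le> a * (1 + a) ^ k * (57 / (8 * \<mu>) * (\<nu>\<^sup>2 * (2 * \<rho> ^ Suc k)) + 1 / (2 * \<mu>) * (\<nu>'\<^sup>2 * (2 * \<rho> ^ k)))"
      unfolding gam using a pos by (intro mult_left_mono add_mono n) auto
    also have "\<dots> = (57 / 4 * (a / (1 + a)) * (\<nu>\<^sup>2 * r ^ Suc k) + a * (\<nu>'\<^sup>2 * r ^ k)) / \<mu>"
    proof -
      define P where "P = (1 + a) ^ k"
      define R where "R = \<rho> ^ k"
      have rk: "r ^ k = R * P" by (simp add: r_def R_def P_def power_mult_distrib)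
      have "57 / 4 * (a / (1 + a)) * (\<nu>\<^sup>2 * (r * (R * P))) = 57 / 4 * \<nu>\<^sup>2 * (R * P) * (a / (1 + a) * r)"
        by (simp only: mult_ac)
      also have "a / (1 + a) * r = a * \<rho>" using a by (simp add: r_def)
      finally have e: "57 / 4 * (a / (1 + a)) * (\<nu>\<^sup>2 * (r * (R * P))) = 57 / 4 * \<nu>\<^sup>2 * (R * P) * (a * \<rho>)" .
      show ?thesis
        unfolding power_Suc rk P_def[symmetric] R_def[symmetric] e using pos
        by (simp add: add_divide_distrib distrib_left mult_ac)
    qed
    also have "\<dots> \<le> (6 * (\<nu>\<^sup>2 * r ^ Suc k) + 6 * (\<nu>'\<^sup>2 * r ^ k)) / \<mu>"
      using a pos r by (intro divide_right_mono add_mono mult_right_mono) (auto simp: field_simps)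
    finally show ?thesis by (simp add: algebra_simps add_divide_distrib)
  qed
  have gp: "(\<Sum>k<n. r ^ k) \<le> 1 / (1 - r)" for n
    using r by (simp add: sum_gp_strict divide_right_mono)
  have "?w0 + (\<Sum>k<K. ?t k) \<le> 6 / \<mu> * \<nu>\<^sup>2 + (\<Sum>k<K. 6 / \<mu> * (\<nu>\<^sup>2 * r ^ Suc k + \<nu>'\<^sup>2 * r ^ k))"
    by (intro add_mono sum_mono w0 t)
  \<comment> \<open>The series in \<open>\<nu>\<close> starts at exponent 1; the initial noise
    supplies its missing term of exponent 0.\<close>
  also have "\<dots> = 6 / \<mu> * (\<nu>\<^sup>2 * (\<Sum>k<Suc K. r ^ k) + \<nu>'\<^sup>2 * (\<Sum>k<K. r ^ k))"
    by (subst sum.lessThan_Suc_shift) (simp add: sum.distrib distrib_left add_divide_distrib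
        flip: sum_distrib_left sum_divide_distrib)
  also have "\<dots> \<le> 6 / \<mu> * (\<nu>\<^sup>2 * (1 / (1 - r)) + \<nu>'\<^sup>2 * (1 / (1 - r)))"
    using pos by (intro mult_left_mono add_mono gp) auto
  also have "\<dots> = 6 / \<mu> * (\<nu>\<^sup>2 + \<nu>'\<^sup>2) / (1 - r)" by (simp add: algebra_simps add_divide_distrib)
  finally show ?thesis by (simp add: r_def a_def)
qed

definition rate_factor :: "real \<Rightarrow> real" where
  "rate_factor \<kappa> = 1 - 1 / (\<kappa> + 2)"

definition rate_const :: "real \<Rightarrow> real \<Rightarrow> real \<Rightarrow> real \<Rightarrow> real \<Rightarrow> real \<Rightarrow> real" where
  "rate_const g \<mu> L \<nu> \<nu>' \<rho> = g * (L / \<mu>)\<^sup>2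
     + 2 * (L / \<mu>) * (\<nu>\<^sup>2 + \<nu>'\<^sup>2) * (1 / (L * \<mu> / (L + \<mu>)) + 1 / \<mu>)
       * ((L / \<mu> + 1) / ((L / \<mu> + 2) * (1 - \<rho>) - 1))"

lemma rate_factor_bounds: "\<kappa> > 0 \<Longrightarrow> 0 < rate_factor \<kappa>" "\<kappa> > 0 \<Longrightarrow> rate_factor \<kappa> < 1"
  by (simp_all add: rate_factor_def)

lemma rate_factor_eq:
  assumes "\<mu> > 0" "L > 0"
  shows "1 + \<mu> / (\<mu> + L) = 1 / rate_factor (L / \<mu>)"
  using assms by (simp add: rate_factor_def field_simps)

text \<open>Brings the claimed constant into the shape of \<open>noise_sum_le\<close>: its last
  fraction is the sum of the geometric series with ratio
  \<open>\<rho> * (1 + \<mu> / (\<mu> + L))\<close>.\<close>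

lemma rate_const_eq:
  assumes "\<mu> > 0" "L > 0"
  shows "rate_const g \<mu> L \<nu> \<nu>' \<rho> = g * (L / \<mu>)\<^sup>2
     + 2 * (2 * (L / \<mu>) + 1) / \<mu> * (\<nu>\<^sup>2 + \<nu>'\<^sup>2) / (1 - \<rho> * (1 + \<mu> / (\<mu> + L)))"
proof -
  have 1: "2 * (L / \<mu>) * s * (1 / (L * \<mu> / (L + \<mu>)) + 1 / \<mu>) = 2 * (2 * (L / \<mu>) + 1) / \<mu> * s" for s
    using assms by (simp add: field_simps)
  have 2: "(L / \<mu> + 1) / ((L / \<mu> + 2) * (1 - \<rho>) - 1) = 1 / (1 - \<rho> * (1 + \<mu> / (\<mu> + L)))"
  proof -
    have "1 + \<mu> / (\<mu> + L) = (L / \<mu> + 2) / (L / \<mu> + 1)"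
    proof -
      have "L / \<mu> + 2 = (L + 2 * \<mu>) / \<mu>" "L / \<mu> + 1 = (L + \<mu>) / \<mu>" "\<mu> + L \<noteq> 0"
        using assms by (simp_all add: field_simps)
      then show ?thesis using assms by (simp add: divide_simps) (simp add: algebra_simps)
    qed
    moreover have "1 - \<rho> * ((\<kappa> + 2) / (\<kappa> + 1)) = ((\<kappa> + 2) * (1 - \<rho>) - 1) / (\<kappa> + 1)" if "\<kappa> > 0" for \<kappa> :: real
      using that by (simp add: field_simps)
    ultimately show ?thesis using assms by simp
  qed
  show ?thesis unfolding rate_const_def 1 2 by simp
qed

context VS_Ave_noise
begin

lemma \<kappa>_pos: "L / \<mu> > 0"
  using \<mu>_pos L_pos by simp

lemma rho_product_less_1:
  assumes "\<rho> < rate_factor (L / \<mu>)"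
  shows "\<rho> * (1 + \<mu> / (\<mu> + L)) < 1"
  using assms rate_factor_bounds[OF \<kappa>_pos] unfolding rate_factor_eq[OF \<mu>_pos L_pos] by simp

lemma rate_const_pos:
  assumes "\<rho> < rate_factor (L / \<mu>)"
  shows "rate_const (gap_function \<mu> X F y0) \<mu> L \<nu> \<nu>' \<rho> > 0"
  unfolding rate_const_eq[OF \<mu>_pos L_pos]
  using gap_nonneg[OF y0_in] rho_product_less_1[OF assms] \<mu>_pos L_pos \<nu>_pos
  by (intro add_nonneg_pos mult_nonneg_nonneg mult_pos_pos divide_pos_pos add_pos_nonneg) auto

lemma averaged_output_eq_if_singleton:
  assumes "X = {p}" "\<omega> \<in> space M"
  shows "averaged_output \<mu> L y K \<omega> = p"
proof -
  have "y i \<omega> = p" for i using y_in[OF assms(2), of i] assms(1) by simp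
  then show ?thesis
    using Gam_pos[OF \<mu>_pos L_pos, of K]
    by (simp add: averaged_output_def sum_gam flip: scaleR_sum_left)
qed

lemma linear_rate:
  assumes N: "N = sample_size \<rho>" and p: "VI_solution X F p"
    and \<rho>: "0 < \<rho>" "\<rho> < rate_factor (L / \<mu>)"
  shows "\<mu> * (\<integral>\<omega>. (norm (averaged_output \<mu> L y K \<omega> - p))\<^sup>2 \<partial>M) / 2
    \<le> rate_const (gap_function \<mu> X F y0) \<mu> L \<nu> \<nu>' \<rho> * rate_factor (L / \<mu>) ^ K"
proof (cases "X = {p}")
  \<comment> \<open>Here \<open>\<mu>\<close> may exceed \<open>L\<close>, which the estimates
    exclude, but the error is 0.\<close>
  case True
  have "(\<integral>\<omega>. (norm (averaged_output \<mu> L y K \<omega> - p))\<^sup>2 \<partial>M) = (\<integral>\<omega>. 0 \<partial>M)"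
    using averaged_output_eq_if_singleton[OF True] by (intro Bochner_Integration.integral_cong) auto
  then show ?thesis
    using rate_const_pos[OF \<rho>(2)] rate_factor_bounds(1)[OF \<kappa>_pos] by simp
next
  case False
  let ?E = "\<integral>\<omega>. (norm (averaged_output \<mu> L y K \<omega> - p))\<^sup>2 \<partial>M" and ?q = "rate_factor (L / \<mu>)"
  let ?g = "gap_function \<mu> X F y0"
  from False p obtain u where "u \<in> X" "u \<noteq> p" "p \<in> X" unfolding VI_solution_def by auto
  then have \<mu>L: "\<mu> \<le> L" using \<mu>_le_L by blast
  have q: "0 < ?q" "?q < 1" by (rule rate_factor_bounds[OF \<kappa>_pos])+
  note r = rho_product_less_1[OF \<rho>(2)]
  have "\<mu> / 2 * Gam \<mu> L K * ?E \<le> (L / \<mu>)\<^sup>2 * ?g + 6 / \<mu> * (\<nu>\<^sup>2 + \<nu>'\<^sup>2) / (1 - \<rho> * (1 + \<mu> / (\<mu> + L)))"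
    using expected_error_le[OF p \<mu>L, of K] noise_sum_le[OF \<mu>_pos \<mu>L \<rho>(1) _ r, of \<nu> \<nu>' K] \<rho> q
    unfolding N by linarith
  also have "\<dots> \<le> rate_const ?g \<mu> L \<nu> \<nu>' \<rho>"
  proof -
    have "6 / \<mu> \<le> 2 * (2 * (L / \<mu>) + 1) / \<mu>" proof (rule divide_right_mono)
      have *: "6 \<le> 2 * (2 * \<kappa> + 1)" if "1 \<le> \<kappa>" for \<kappa> :: real using that by simp
      show "6 \<le> 2 * (2 * (L / \<mu>) + 1)" by (rule *) (use \<mu>L \<mu>_pos in simp)
    qed (use \<mu>_pos in simp)
    then have "6 / \<mu> * (\<nu>\<^sup>2 + \<nu>'\<^sup>2) / (1 - \<rho> * (1 + \<mu> / (\<mu> + L)))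
        \<le> 2 * (2 * (L / \<mu>) + 1) / \<mu> * (\<nu>\<^sup>2 + \<nu>'\<^sup>2) / (1 - \<rho> * (1 + \<mu> / (\<mu> + L)))"
      by (rule divide_right_mono[OF mult_right_mono]) (use r in auto)
    then show ?thesis unfolding rate_const_eq[OF \<mu>_pos L_pos] by (simp add: mult.commute)
  qed
  finally have "\<mu> / 2 * (1 / ?q) ^ K * ?E \<le> rate_const ?g \<mu> L \<nu> \<nu>' \<rho>"
    by (simp only: Gam_eq_power rate_factor_eq[OF \<mu>_pos L_pos])
  then have "\<mu> / 2 * (1 / ?q) ^ K * ?E * ?q ^ K \<le> rate_const ?g \<mu> L \<nu> \<nu>' \<rho> * ?q ^ K"
    using q by (intro mult_right_mono) auto
  then show ?thesis using q by (simp add: power_one_over field_simps)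
qed

end

section \<open>Complexity\<close>

lemma geometric_steps:
  fixes q B \<epsilon> :: real
  assumes "0 < q" "q < 1" "0 < \<epsilon>" "\<epsilon> \<le> B"
  obtains K :: nat where "B * q ^ K \<le> \<epsilon>" "real K \<le> ln (B / \<epsilon>) / (- ln q) + 1"
proof
  let ?t = "ln (B / \<epsilon>) / (- ln q)"
  let ?K = "nat \<lceil>?t\<rceil>"
  have l: "- ln q > 0" using assms by simp
  have t: "?t \<ge> 0" using assms l by (intro divide_nonneg_pos) auto
  show "real ?K \<le> ?t + 1" using t by linarith
  have "?t \<le> real ?K" by linarith
  then have "ln (B / \<epsilon>) \<le> real ?K * (- ln q)" by (rule iffD1[OF pos_divide_le_eq[OF l]])
  then have "ln (B / \<epsilon>) \<le> ln ((1 / q) ^ ?K)" using assms by (simp add: ln_realpow ln_div)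
  then have "B / \<epsilon> \<le> (1 / q) ^ ?K" using assms by (subst (asm) ln_le_cancel_iff) auto
  then show "B * q ^ ?K \<le> \<epsilon>" using assms by (simp add: power_one_over field_simps)
qed

lemma evaluations_le:
  assumes "0 < \<rho>" "\<rho> < 1"
  shows "real (evaluations (sample_size \<rho>) K) \<le> 2 / (1 / \<rho> - 1) * (1 / \<rho>) ^ K"
proof -
  have "real (evaluations (sample_size \<rho>) K) = 2 * (\<Sum>k<K. real (sample_size \<rho> k))"
    by (simp add: evaluations_def sum_distrib_left)
  also have "\<dots> \<le> 2 * (\<Sum>k<K. (1 / \<rho>) ^ k)"
    using sample_size_bounds(1)[OF assms] by (intro mult_left_mono sum_mono) auto
  also have "\<dots> = 2 / (1 / \<rho> - 1) * ((1 / \<rho>) ^ K - 1)"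
    using assms by (subst geometric_sum) auto
  also have "\<dots> \<le> 2 / (1 / \<rho> - 1) * (1 / \<rho>) ^ K"
    using assms by (intro mult_left_mono) auto
  finally show ?thesis .
qed

text \<open>With \<open>\<rho> = q powr \<beta>\<close>, raising \<open>1 / \<rho>\<close> to the
  power \<open>ln (B / \<epsilon>) / (- ln q)\<close> gives exactly
  \<open>(B / \<epsilon>) powr \<beta>\<close>; rounding the number of steps up costs one more
  factor \<open>1 / \<rho>\<close>.\<close>

lemma evaluations_bigo:
  fixes K :: "real \<Rightarrow> nat"
  assumes q: "0 < q" "q < 1" and \<beta>: "\<beta> > 0" and B: "B > 0"
    and K: "\<And>\<epsilon>. 0 < \<epsilon> \<Longrightarrow> \<epsilon> \<le> B \<Longrightarrow> real (K \<epsilon>) \<le> ln (B / \<epsilon>) / (- ln q) + 1"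
  shows "(\<lambda>\<epsilon>. real (evaluations (sample_size (q powr \<beta>)) (K \<epsilon>))) \<in> O[at_right 0](\<lambda>\<epsilon>. (1 / \<epsilon>) powr \<beta>)"
proof -
  define \<rho> where "\<rho> = q powr \<beta>"
  have l: "- ln q > 0" using q by simp
  have \<rho>: "0 < \<rho>" "\<rho> < 1" using q \<beta> powr_less_mono'[of q 0 \<beta>] by (auto simp: \<rho>_def)
  have ln\<rho>: "ln (1 / \<rho>) = \<beta> * (- ln q)" using q by (simp add: \<rho>_def ln_div ln_powr)
  define c where "c = 2 / (1 / \<rho> - 1)"
  have c: "c > 0" using \<rho> by (simp add: c_def)
  have "norm (real (evaluations (sample_size \<rho>) (K \<epsilon>))) \<le> c / \<rho> * B powr \<beta> * norm ((1 / \<epsilon>) powr \<beta>)"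
    if \<epsilon>: "0 < \<epsilon>" "\<epsilon> < B" for \<epsilon>
  proof -
    have "(1 / \<rho>) ^ K \<epsilon> = (1 / \<rho>) powr real (K \<epsilon>)" using \<rho> by (simp add: powr_realpow)
    also have "\<dots> \<le> (1 / \<rho>) powr (ln (B / \<epsilon>) / (- ln q) + 1)"
      using \<rho> \<epsilon> by (intro powr_mono K) auto
    also have "\<dots> = (1 / \<rho>) powr (ln (B / \<epsilon>) / (- ln q)) / \<rho>"
      unfolding powr_add using \<rho> by simp
    also have "(1 / \<rho>) powr (ln (B / \<epsilon>) / (- ln q)) = exp (\<beta> * ln (B / \<epsilon>))"
      using \<rho>(1) l unfolding powr_def ln\<rho> by simp
    also have "\<dots> = (B * (1 / \<epsilon>)) powr \<beta>" using \<epsilon> by (simp add: powr_def)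
    also have "\<dots> = B powr \<beta> * (1 / \<epsilon>) powr \<beta>" by (rule powr_mult)
    finally have "c * (1 / \<rho>) ^ K \<epsilon> \<le> c * (B powr \<beta> * (1 / \<epsilon>) powr \<beta> / \<rho>)"
      using c by (intro mult_left_mono) auto
    then show ?thesis
      using evaluations_le[OF \<rho>, of "K \<epsilon>"] by (simp add: c_def mult_ac)
  qed
  then have "\<forall>\<^sub>F \<epsilon> in at_right 0. norm (real (evaluations (sample_size \<rho>) (K \<epsilon>)))
      \<le> c / \<rho> * B powr \<beta> * norm ((1 / \<epsilon>) powr \<beta>)"
    using B by (intro eventually_at_rightI[of 0 B]) auto
  then show ?thesis unfolding \<rho>_def by (rule bigoI)
qed

context VS_Ave_noise
begin

lemma steps_required_bounds:
  assumes N: "N = sample_size \<rho>" and p: "VI_solution X F p"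
    and \<rho>: "0 < \<rho>" "\<rho> < rate_factor (L / \<mu>)"
  defines "B \<equiv> 2 * rate_const (gap_function \<mu> X F y0) \<mu> L \<nu> \<nu>' \<rho> / \<mu>"
  shows "B > 0"
    and "\<epsilon> > 0 \<Longrightarrow> \<exists>K. eps_solution M p (averaged_output \<mu> L y) \<epsilon> K"
    and "0 < \<epsilon> \<Longrightarrow> \<epsilon> \<le> B \<Longrightarrow>
      real (steps_required M p (averaged_output \<mu> L y) \<epsilon>) \<le> ln (B / \<epsilon>) / (- ln (rate_factor (L / \<mu>))) + 1"
    and "0 < \<epsilon> \<Longrightarrow> \<epsilon> \<le> exp (-1) * B \<Longrightarrow>
      real (steps_required M p (averaged_output \<mu> L y) \<epsilon>) \<le> 4 * (L / \<mu> * ln (B / \<epsilon>))"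
proof -
  let ?q = "rate_factor (L / \<mu>)" and ?ybar = "averaged_output \<mu> L y" and ?\<kappa> = "L / \<mu>"
  have q: "0 < ?q" "?q < 1" by (rule rate_factor_bounds[OF \<kappa>_pos])+
  show B: "B > 0" unfolding B_def using rate_const_pos[OF \<rho>(2)] \<mu>_pos by simp
  have sol: "eps_solution M p ?ybar \<epsilon> K" if "B * ?q ^ K \<le> \<epsilon>" for K \<epsilon>
  proof -
    have "(\<integral>\<omega>. (norm (?ybar K \<omega> - p))\<^sup>2 \<partial>M) \<le> B * ?q ^ K"
      using linear_rate[OF N p \<rho>, of K] \<mu>_pos by (simp add: B_def field_simps)
    moreover have "integrable M (\<lambda>\<omega>. (norm (?ybar K \<omega> - p))\<^sup>2)"
      by (intro square_integrable_norm_sq square_integrable_diff averaged_output_square_integrable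
          square_integrable_const)
    ultimately show ?thesis using that by (simp add: eps_solution_def)
  qed
  have steps: "real (steps_required M p ?ybar \<epsilon>) \<le> ln (B / \<epsilon>) / (- ln ?q) + 1" if \<epsilon>: "0 < \<epsilon>" "\<epsilon> \<le> B" for \<epsilon>
  proof -
    obtain K where K: "B * ?q ^ K \<le> \<epsilon>" "real K \<le> ln (B / \<epsilon>) / (- ln ?q) + 1"
      using geometric_steps[OF q \<epsilon>] by blast
    have "steps_required M p ?ybar \<epsilon> \<le> K"
      unfolding steps_required_def by (intro Least_le sol K)
    then show ?thesis using K(2) by linarith
  qed
  then show "0 < \<epsilon> \<Longrightarrow> \<epsilon> \<le> B \<Longrightarrow>
      real (steps_required M p ?ybar \<epsilon>) \<le> ln (B / \<epsilon>) / (- ln ?q) + 1" .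
  show "\<exists>K. eps_solution M p ?ybar \<epsilon> K" if "\<epsilon> > 0"
  proof (cases "\<epsilon> \<le> B")
    case True
    with that show ?thesis using geometric_steps[OF q] sol by metis
  next
    case False
    then show ?thesis using sol[of 0 \<epsilon>] by auto
  qed
  show "real (steps_required M p ?ybar \<epsilon>) \<le> 4 * (?\<kappa> * ln (B / \<epsilon>))" if \<epsilon>: "0 < \<epsilon>" "\<epsilon> \<le> exp (-1) * B"
  proof -
    \<comment> \<open>The threshold \<open>exp (-1) * B\<close> makes the logarithm at least 1. With
      \<open>?\<kappa> \<ge> 1\<close> the additive 2 and the rounding term are then absorbed, and 1
      + 2 + 1 gives the factor 4.\<close>
    have "exp 1 \<le> B / \<epsilon>" using \<epsilon> by (simp add: exp_minus field_simps)
    then have l: "ln (B / \<epsilon>) \<ge> 1" using \<epsilon> B by (subst ln_ge_iff) auto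
    show ?thesis
    proof (cases "X = {p}")
      case True
      have "(\<integral>\<omega>. (norm (?ybar 0 \<omega> - p))\<^sup>2 \<partial>M) = (\<integral>\<omega>. 0 \<partial>M)"
        using averaged_output_eq_if_singleton[OF True] by (intro Bochner_Integration.integral_cong) auto
      moreover have "integrable M (\<lambda>\<omega>. (norm (?ybar 0 \<omega> - p))\<^sup>2)"
        by (intro square_integrable_norm_sq square_integrable_diff averaged_output_square_integrable
            square_integrable_const)
      ultimately have "eps_solution M p ?ybar \<epsilon> 0" using \<epsilon> by (simp add: eps_solution_def)
      then have "steps_required M p ?ybar \<epsilon> \<le> 0" unfolding steps_required_def by (rule Least_le)
      moreover have "0 \<le> ?\<kappa> * ln (B / \<epsilon>)" using l \<kappa>_pos by (intro mult_nonneg_nonneg) auto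
      ultimately show ?thesis by simp
    next
      case False
      from False p obtain u where "u \<in> X" "u \<noteq> p" "p \<in> X" unfolding VI_solution_def by auto
      then have "\<mu> \<le> L" using \<mu>_le_L by blast
      then have \<kappa>: "?\<kappa> \<ge> 1" using \<mu>_pos by simp
      have "exp (-1) * B \<le> 1 * B" using B by (intro mult_right_mono) auto
      then have "\<epsilon> \<le> B" using \<epsilon> by simp
      have "1 / (?\<kappa> + 2) \<le> - ln ?q" using ln_le_minus_one[OF q(1)] by (simp add: rate_factor_def)
      then have "ln (B / \<epsilon>) / (- ln ?q) \<le> ln (B / \<epsilon>) / (1 / (?\<kappa> + 2))"
        using l \<kappa> by (intro divide_left_mono mult_pos_pos) (use q in auto)
      then have "real (steps_required M p ?ybar \<epsilon>) \<le> ln (B / \<epsilon>) * (?\<kappa> + 2) + 1"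
        using steps[OF \<epsilon>(1) \<open>\<epsilon> \<le> B\<close>] by simp
      also have "\<dots> \<le> 4 * (?\<kappa> * ln (B / \<epsilon>))"
      proof -
        have "ln (B / \<epsilon>) \<le> ?\<kappa> * ln (B / \<epsilon>)"
          using mult_right_mono[OF \<kappa>, of "ln (B / \<epsilon>)"] l by simp
        then show ?thesis using l unfolding distrib_left mult.commute[of "ln (B / \<epsilon>)" ?\<kappa>] by linarith
      qed
      finally show ?thesis .
    qed
  qed
qed

end

text \<open>\<open>A\<close> and \<open>\<delta>\<close> are chosen before the problem data, so the
  step bound is uniform in them; \<open>\<delta>\<close> keeps \<open>\<epsilon>\<close> away from
  the range where the logarithm is near 0 or negative. The constant in the evaluation bound may
  depend on the problem.\<close>

theorem theorem2:
  shows "\<exists>A \<delta> :: real. A > 0 \<and> \<delta> > 0 \<and>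
    (\<forall>(M :: 'w measure) (X :: (real^'n) set) F G (\<xi> :: 'w \<Rightarrow> real^'d) \<mu> L S y0 x y \<nu> \<nu>' xs \<rho>.
      VS_Ave_noise M X F G \<xi> \<mu> L S (sample_size \<rho>) y0 x y \<nu> \<nu>' \<longrightarrow>
      VI_solution X F xs \<longrightarrow>
      0 < \<rho> \<longrightarrow> \<rho> < 1 - 1 / (L / \<mu> + 2) \<longrightarrow>
      (let \<kappa> = L / \<mu>;
           c = L * \<mu> / (L + \<mu>);
           q = 1 - 1 / (\<kappa> + 2);
           C = gap_function \<mu> X F y0 * \<kappa>\<^sup>2
             + 2 * \<kappa> * (\<nu>\<^sup>2 + \<nu>'\<^sup>2) * (1 / c + 1 / \<mu>) * ((\<kappa> + 1) / ((\<kappa> + 2) * (1 - \<rho>) - 1));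
           Cbar = 2 * C / \<mu>;
           ybar = averaged_output \<mu> L y
       in
         (\<forall>K. integrable M (\<lambda>\<omega>. (norm (ybar K \<omega> - xs))\<^sup>2) \<and>
              \<mu> * (\<integral>\<omega>. (norm (ybar K \<omega> - xs))\<^sup>2 \<partial>M) / 2 \<le> C * q ^ K) \<and>
         (\<forall>\<beta>. \<beta> > 1 \<longrightarrow> \<rho> = q powr \<beta> \<longrightarrow>
            (\<forall>\<epsilon>>0. \<exists>K. eps_solution M xs ybar \<epsilon> K) \<and>
            (\<forall>\<epsilon>. 0 < \<epsilon> \<and> \<epsilon> \<le> \<delta> * Cbar \<longrightarrow>
               real (steps_required M xs ybar \<epsilon>) \<le> A * (\<kappa> * ln (Cbar / \<epsilon>))) \<and>
            (\<lambda>\<epsilon>. real (evaluations (sample_size \<rho>) (steps_required M xs ybar \<epsilon>)))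
              \<in> O[at_right 0](\<lambda>\<epsilon>. (1 / \<epsilon>) powr \<beta>))))"
\<comment> \<open>The witnesses stay schematic here; the final \<open>show\<close> instantiates them
  to 4 and \<open>exp (-1)\<close>.\<close>
proof (intro exI conjI allI impI)
  fix M :: "'w measure" and X :: "(real^'n) set" and F G and \<xi> :: "'w \<Rightarrow> real^'d"
    and \<mu> L S y0 x y \<nu> \<nu>' xs \<rho>
  assume "VS_Ave_noise M X F G \<xi> \<mu> L S (sample_size \<rho>) y0 x y \<nu> \<nu>'"
    and xs: "VI_solution X F xs" and \<rho>: "0 < \<rho>" "\<rho> < 1 - 1 / (L / \<mu> + 2)"
  then interpret VS_Ave_noise M X F G \<xi> \<mu> L S "sample_size \<rho>" y0 x y \<nu> \<nu>' by simp
  have \<rho>': "\<rho> < rate_factor (L / \<mu>)" using \<rho>(2) by (simp add: rate_factor_def)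
  note steps = steps_required_bounds[OF refl xs \<rho>(1) \<rho>']
  have int: "integrable M (\<lambda>\<omega>. (norm (averaged_output \<mu> L y K \<omega> - xs))\<^sup>2)" for K
    by (intro square_integrable_norm_sq square_integrable_diff averaged_output_square_integrable
        square_integrable_const)
  have "(\<lambda>\<epsilon>. real (evaluations (sample_size \<rho>) (steps_required M xs (averaged_output \<mu> L y) \<epsilon>)))
      \<in> O[at_right 0](\<lambda>\<epsilon>. (1 / \<epsilon>) powr \<beta>)"
    if "\<beta> > 1" "\<rho> = rate_factor (L / \<mu>) powr \<beta>" for \<beta>
    using evaluations_bigo[OF rate_factor_bounds[OF \<kappa>_pos] _ steps(1,3), of \<beta>]
    unfolding that(2)[symmetric] using that(1) by simp
  then show "let \<kappa> = L / \<mu>;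
           c = L * \<mu> / (L + \<mu>);
           q = 1 - 1 / (\<kappa> + 2);
           C = gap_function \<mu> X F y0 * \<kappa>\<^sup>2
             + 2 * \<kappa> * (\<nu>\<^sup>2 + \<nu>'\<^sup>2) * (1 / c + 1 / \<mu>) * ((\<kappa> + 1) / ((\<kappa> + 2) * (1 - \<rho>) - 1));
           Cbar = 2 * C / \<mu>;
           ybar = averaged_output \<mu> L y
       in
         (\<forall>K. integrable M (\<lambda>\<omega>. (norm (ybar K \<omega> - xs))\<^sup>2) \<and>
              \<mu> * (\<integral>\<omega>. (norm (ybar K \<omega> - xs))\<^sup>2 \<partial>M) / 2 \<le> C * q ^ K) \<and>
         (\<forall>\<beta>. \<beta> > 1 \<longrightarrow> \<rho> = q powr \<beta> \<longrightarrow>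
            (\<forall>\<epsilon>>0. \<exists>K. eps_solution M xs ybar \<epsilon> K) \<and>
            (\<forall>\<epsilon>. 0 < \<epsilon> \<and> \<epsilon> \<le> exp (-1) * Cbar \<longrightarrow>
               real (steps_required M xs ybar \<epsilon>) \<le> 4 * (\<kappa> * ln (Cbar / \<epsilon>))) \<and>
            (\<lambda>\<epsilon>. real (evaluations (sample_size \<rho>) (steps_required M xs ybar \<epsilon>)))
              \<in> O[at_right 0](\<lambda>\<epsilon>. (1 / \<epsilon>) powr \<beta>))"
    unfolding Let_def rate_const_def[symmetric] rate_factor_def[symmetric]
    by (intro conjI allI impI int linear_rate[OF refl xs \<rho>(1) \<rho>'] steps(2,4)) auto
qed auto

end
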